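(* Let $\xi\in\Xi$, and let $\delta>0$, $0<\varepsilon\le1$ and $C>1$ be such that $\varepsilon':=\varepsilon(C+1)/(C-1)<1$. Let $V\in\mathbb{R}^{n\times K}$ be either a rescaled Rademacher random matrix with $$K\geq 6\varepsilon^{-2}\ln\big(2n(9C/\varepsilon)^{m+1}/\delta\big),$$ or a P-SRHT random matrix with $$K\geq 2(\varepsilon^2-\varepsilon^3/3)^{-1}\ln\big(4(9C/\varepsilon)^{m+1}/\delta\big)\Big(1+\sqrt{8\ln\big(4n(9C/\varepsilon)^{m+1}/\delta\big)}\Big)^2 .$$ Let $P_m(\xi)\in Y_m$ be defined by $P_m(\xi)=\operatorname{argmin}_{P\in Y_m}\|(I-PA(\xi))V\|_F$. Then $$\|I-P_m(\xi)A(\xi)\|_F\leq\sqrt{\frac{1+\varepsilon'}{1-\varepsilon'}}\ \min_{P\in Y_m}\|I-PA(\xi)\|_F$$ holds with probability at least $1-\delta$ (with respect to $V$).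
   Context: $\Xi$ is a parameter set and $A:\Xi\to\mathbb{R}^{n\times n}$ is a matrix-valued function with invertible values. Given points $\xi_1,\dots,\xi_m\in\Xi$, set $P_i=A(\xi_i)^{-1}$ and $Y_m=\mathrm{span}\{P_1,\dots,P_m\}\subset\mathbb{R}^{n\times n}$. $I$ is the $n\times n$ identity and $\|\cdot\|_F$ the Frobenius norm. Standing assumption: the linear map $P\mapsto PA(\xi)V$ is injective on $Y_m$, so that the minimizer $P_m(\xi)$ is unique. Rescaled Rademacher matrix: $V\in\mathbb{R}^{n\times K}$ with i.i.d. entries equal to $+K^{-1/2}$ or $-K^{-1/2}$ with probability $1/2$ each. Hadamard matrices: for $s$ a power of $2$, $H_s\in\{\pm1\}^{s\times s}$ is defined by $H_1=(1)$, $H_2=\begin{pmatrix}1&1\\1&-1\end{pmatrix}$, $H_{2^{k+1}}=H_2\otimes H_{2^k}$. P-SRHT matrix: let $s=2^{\lceil\log_2 n\rceil}$ and $K\le s$. An SRHT matrix of size $s\times K$ is $K^{-1/2}(RH_sD)^T$, where $D\in\mathbb{R}^{s\times s}$ is diagonal with independent Rademacher ($\pm1$ with probability $1/2$) diagonal entries, and $R\in\mathbb{R}^{K\times s}$ consists of $K$ rows of the $s\times s$ identity chosen uniformly at random without replacement (independently of $D$). A P-SRHT matrix $V\in\mathbb{R}^{n\times K}$ consists of the first $n$ rows of an SRHT matrix of size $s\times K$. *)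

theory Defs
  imports "HOL-Probability.Probability"
begin

text \<open>
  An n by K real matrix has type \<open>real ^ 'k ^ 'n\<close> with n = \<open>CARD('n)\<close> and K = \<open>CARD('k)\<close>.
  The type class \<open>norm\<close> on this type is the Euclidean norm of all the entries, that is,
  the Frobenius norm. Probabilities are taken with respect to the law of the random
  matrix, which is finitely supported and hence given as a \<open>pmf\<close>.
\<close>

definition rademacher_pmf :: "real pmf" where
  "rademacher_pmf = pmf_of_set {-1, 1}"

definition rademacher_matrix_pmf :: "(real ^ 'k ^ 'n) pmf" where
  "rademacher_matrix_pmf =
     map_pmf (\<lambda>W. \<chi> i j. W (i, j) / sqrt (real CARD('k)))
       (Pi_pmf (UNIV :: ('n \<times> 'k) set) 0 (\<lambda>_. rademacher_pmf))"

text \<open>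
  In the construction of Hadamard matrices, matrices of size s are functions
  \<open>nat \<Rightarrow> nat \<Rightarrow> real\<close>, of which only the entries with indices below s (counted from 0)
  are meaningful. In \<open>kronecker p A B\<close>, the matrix B has size p.
\<close>

definition kronecker ::
  "nat \<Rightarrow> (nat \<Rightarrow> nat \<Rightarrow> real) \<Rightarrow> (nat \<Rightarrow> nat \<Rightarrow> real) \<Rightarrow> nat \<Rightarrow> nat \<Rightarrow> real" where
  "kronecker p A B i j = A (i div p) (j div p) * B (i mod p) (j mod p)"

definition hadamard2 :: "nat \<Rightarrow> nat \<Rightarrow> real" where
  "hadamard2 i j = (if i = 1 \<and> j = 1 then -1 else 1)"

text \<open>\<open>hadamard k\<close> is the Hadamard matrix of size \<open>2 ^ k\<close>.\<close>

primrec hadamard :: "nat \<Rightarrow> nat \<Rightarrow> nat \<Rightarrow> real" where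
  "hadamard 0 = (\<lambda>i j. 1)"
| "hadamard (Suc k) = kronecker (2 ^ k) hadamard2 (hadamard k)"

definition srht_exponent :: "nat \<Rightarrow> nat" where
  "srht_exponent n = nat \<lceil>log 2 (real n)\<rceil>"

definition srht_size :: "nat \<Rightarrow> nat" where
  "srht_size n = 2 ^ srht_exponent n"

text \<open>
  The matrix \<open>(R H D)\<^sup>T / sqrt K\<close> of size \<open>2 ^ k\<close> by K, where H is the Hadamard matrix of size
  \<open>2 ^ k\<close>, D is the diagonal matrix with diagonal d, and row j of R is row \<open>r j\<close> of the identity.
\<close>

definition srht_matrix ::
  "nat \<Rightarrow> ('k \<Rightarrow> nat) \<Rightarrow> (nat \<Rightarrow> real) \<Rightarrow> nat \<Rightarrow> 'k \<Rightarrow> real" where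
  "srht_matrix k r d i j =
     (let R = (\<lambda>j l. if l = r j then 1 else 0);
          D = (\<lambda>p i. if p = i then d i else 0)
      in (\<Sum>l<2 ^ k. \<Sum>p<2 ^ k. R j l * hadamard k l p * D p i) / sqrt (real CARD('k)))"

text \<open>
  The function \<open>idx\<close> numbers the row indices by 0, ..., n - 1 and makes sense of the first n rows.
  K rows drawn uniformly without replacement, in the order of drawing, are a uniformly
  distributed injective map into the set of rows. This is only meaningful if
  \<open>CARD('k) \<le> srht_size CARD('n)\<close>, as otherwise there is no such map.
\<close>

definition psrht_matrix_pmf :: "('n \<Rightarrow> nat) \<Rightarrow> (real ^ 'k ^ 'n) pmf" where
  "psrht_matrix_pmf idx =
     map_pmf (\<lambda>(d, r). \<chi> i j. srht_matrix (srht_exponent CARD('n)) r d (idx i) j)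
       (pair_pmf
         (Pi_pmf {..<srht_size CARD('n)} 0 (\<lambda>_. rademacher_pmf))
         (pmf_of_set {r :: 'k \<Rightarrow> nat. inj r \<and> range r \<subseteq> {..<srht_size CARD('n)}}))"

text \<open>
  P is a minimizer over Y of the norm of \<open>(I - P B) V\<close>. If \<open>P \<mapsto> P B V\<close> is injective on the
  subspace Y, there is exactly one such P. As V is random, injectivity is not imposed
  on all its realizations; instead the estimate is stated for every minimizer
  (there always is one), which amounts to the estimate for the minimizer when it is unique.
\<close>

definition sketched_minimizer ::
  "real ^ 'n ^ 'n \<Rightarrow> real ^ 'k ^ 'n \<Rightarrow> (real ^ 'n ^ 'n) set \<Rightarrow> real ^ 'n ^ 'n \<Rightarrow> bool" where
  "sketched_minimizer B V Y = is_arg_min (\<lambda>P. norm ((mat 1 - P ** B) ** V)) (\<lambda>P. P \<in> Y)"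

end

theory Submission
  imports Defs
begin

text \<open>
  Write \<open>B = A \<xi>\<close>. All residuals \<open>I - P B\<close> with \<open>P \<in> Y\<close> lie in the subspace \<open>W\<close> spanned by \<open>I\<close>
  and the m matrices \<open>P\<^sub>i B\<close>, whose dimension is at most \<open>m + 1\<close>. If, for some \<open>g > 0\<close>, the squared
  norm of \<open>M V\<close> lies between \<open>g (1 - \<epsilon>')\<close> and \<open>g (1 + \<epsilon>')\<close> times that of \<open>M\<close> for every \<open>M \<in> W\<close>,
  then a minimizer of the sketched norm loses at most the factor \<open>sqrt ((1 + \<epsilon>') / (1 - \<epsilon>'))\<close>
  (\<open>sketched_minimizer_quasi_optimal\<close>). The scale \<open>g\<close> is irrelevant for the comparison, a freedom
  that the Rademacher case exploits.

  Uniformity over \<open>W\<close> comes from a finite net. By compactness, a bound \<open>g \<epsilon>\<close> on the quadratic form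
  \<open>norm (M V)\<^sup>2 - g norm M\<^sup>2\<close> at the points of an h-net of the unit ball improves to the bound
  \<open>g \<epsilon> / (1 - 2 h)\<close> on the whole ball (\<open>quadratic_form_bound_from_net\<close>), and \<open>h = 1 / (C + 1)\<close>
  turns \<open>\<epsilon>\<close> into \<open>\<epsilon>'\<close>. Counting lattice points shows that \<open>(9 / h) ^ (m + 1)\<close> net points
  suffice (\<open>subspace_unit_ball_net\<close>), which is at most \<open>(9 C / \<epsilon>) ^ (m + 1)\<close> because \<open>\<epsilon>' < 1\<close>.
  A union bound reduces everything to a single matrix M of norm 1, for which the failure
  probability has to be at most \<open>\<delta> / (9 C / \<epsilon>) ^ (m + 1)\<close>
  (\<open>quasi_optimality_from_pointwise_embedding\<close>).

  For a Rademacher matrix, \<open>K norm (M V)\<^sup>2\<close> is a sum of K independent copies of \<open>norm (M x)\<^sup>2\<close> with a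
  random sign vector x. By convexity, exponential moments of \<open>norm (M x)\<^sup>2\<close> are controlled by those
  of \<open>(v \<bullet> x)\<^sup>2\<close> for single vectors v in the unit ball, which are dominated by the ones of a squared
  Gaussian. Chernoff bounds then apply, the lower tail needing only the fourth moment. For \<open>\<epsilon>\<close>
  close to 1, the upper tail of \<open>norm (M V)\<^sup>2\<close> at \<open>1 + \<epsilon>\<close> can decay more slowly than
  \<open>exp (- K \<epsilon>\<^sup>2 / 6)\<close>, as the case of chi-square variables shows; the scale \<open>g = 1 + \<epsilon> / 20\<close> moves the
  thresholds to \<open>g (1 + \<epsilon>)\<close> and \<open>g (1 - \<epsilon>)\<close>, where both tails decay at least at this rate
  (\<open>rademacher_failure_prob\<close>).

  For a P-SRHT matrix, \<open>norm (M V)\<^sup>2\<close> is the average of K numbers sampled without replacement from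
  a family of mean 1. The random signs make all numbers of the family smaller than
  \<open>b = (1 + sqrt (8 ln (4 n (9 C / \<epsilon>) ^ (m + 1) / \<delta>)))\<^sup>2\<close> with high probability, by the same Gaussian
  domination. Given this, Maclaurin's inequality for elementary symmetric polynomials compares
  sampling without and with replacement, and the Chernoff bounds for variables with values
  between 0 and b give the exponent \<open>K (\<epsilon>\<^sup>2 - \<epsilon>\<^sup>3 / 3) / (2 b)\<close> (\<open>psrht_failure_prob\<close>).
\<close>

section \<open>Elementary inequalities\<close>

text \<open>
  The quadratic term is what makes the lower tail of a Rademacher sketch strictly better
  than \<open>exp (- K s\<^sup>2 / 6)\<close>; it pays for the shift of the lower threshold.
\<close>

lemma one_minus_le_exp_quadratic:
  fixes x :: real
  assumes "0 \<le> x" "x < 1"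
  shows "1 - x \<le> exp (- x - x\<^sup>2 / 2)"
proof -
  have "- 0 - 0\<^sup>2 / 2 - ln (1 - 0) \<le> - x - x\<^sup>2 / 2 - ln (1 - x)"
  proof (rule DERIV_nonneg_imp_nondecreasing [OF assms(1)])
    fix y assume y: "0 \<le> y" "y \<le> x"
    have "((\<lambda>x. - x - x\<^sup>2 / 2 - ln (1 - x)) has_real_derivative y\<^sup>2 / (1 - y)) (at y)"
      using y assms by (auto intro!: derivative_eq_intros simp: field_simps power2_eq_square)
    moreover have "0 \<le> y\<^sup>2 / (1 - y)" using y assms by simp
    ultimately show "\<exists>d. ((\<lambda>x. - x - x\<^sup>2 / 2 - ln (1 - x)) has_real_derivative d) (at y) \<and> 0 \<le> d"
      by blast
  qed
  then have "ln (1 - x) \<le> - x - x\<^sup>2 / 2" by simp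
  then show ?thesis
    using assms by (simp add: ln_le_cancel_iff [symmetric] del: ln_le_cancel_iff)
qed

lemma exp_minus_le_quadratic:
  fixes x :: real
  assumes "0 \<le> x"
  shows "exp (- x) \<le> 1 - x + x\<^sup>2 / 2"
proof -
  have "1 - 0 + 0\<^sup>2 / 2 - exp (- 0) \<le> 1 - x + x\<^sup>2 / 2 - exp (- x)"
  proof (rule DERIV_nonneg_imp_nondecreasing [OF assms])
    fix y :: real assume "0 \<le> y"
    have "((\<lambda>x. 1 - x + x\<^sup>2 / 2 - exp (- x)) has_real_derivative (- 1 + y + exp (- y))) (at y)"
      by (auto intro!: derivative_eq_intros)
    moreover have "0 \<le> - 1 + y + exp (- y)"
      using exp_ge_add_one_self [of "- y"] by simp
    ultimately show "\<exists>d. ((\<lambda>x. 1 - x + x\<^sup>2 / 2 - exp (- x)) has_real_derivative d) (at y) \<and> 0 \<le> d"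
      by blast
  qed
  then show ?thesis by simp
qed

text \<open>
  The upper tail of a Rademacher sketch is needed for deviations around 1, where Taylor
  polynomials of the logarithm are too weak. This Pade-type bound is precise enough there.
\<close>

lemma ln_one_plus_le_pade:
  fixes x :: real
  assumes "0 \<le> x"
  shows "ln (1 + x) \<le> x - 3 * x\<^sup>2 / (6 + 4 * x)"
proof -
  have "0 - 3 * 0\<^sup>2 / (6 + 4 * 0) - ln (1 + 0) \<le> x - 3 * x\<^sup>2 / (6 + 4 * x) - ln (1 + x)"
  proof (rule DERIV_nonneg_imp_nondecreasing [OF assms])
    fix y :: real assume y: "0 \<le> y" "y \<le> x"
    have eq: "1 - ((6 * y) * (6 + 4 * y) - 3 * y\<^sup>2 * 4) / (6 + 4 * y)\<^sup>2 - 1 / (1 + y)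
        = 4 * y ^ 3 / ((6 + 4 * y)\<^sup>2 * (1 + y))"
    proof -
      define p where "p = 6 + 4 * y"
      have nz: "p \<noteq> 0" "1 + y \<noteq> 0" using y by (auto simp: p_def)
      have "p\<^sup>2 * (1 + y) - (6 * y * p - 12 * y\<^sup>2) * (1 + y) - p\<^sup>2 = 4 * y ^ 3"
        by (simp add: p_def power2_eq_square power3_eq_cube algebra_simps)
      then show ?thesis
        unfolding p_def [symmetric] using nz by (simp add: field_simps)
    qed
    show "\<exists>d. ((\<lambda>x. x - 3 * x\<^sup>2 / (6 + 4 * x) - ln (1 + x)) has_real_derivative d) (at y) \<and> 0 \<le> d"
    proof (intro exI conjI)
      show "((\<lambda>x. x - 3 * x\<^sup>2 / (6 + 4 * x) - ln (1 + x)) has_real_derivative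
          1 - ((6 * y) * (6 + 4 * y) - 3 * y\<^sup>2 * 4) / (6 + 4 * y)\<^sup>2 - 1 / (1 + y)) (at y)"
        using y by (auto intro!: derivative_eq_intros simp: power2_eq_square)
      show "0 \<le> 1 - ((6 * y) * (6 + 4 * y) - 3 * y\<^sup>2 * 4) / (6 + 4 * y)\<^sup>2 - 1 / (1 + y)"
        unfolding eq using y by simp
    qed
  qed
  then show ?thesis by simp
qed

lemma ln_one_plus_ge_quadratic:
  fixes x :: real
  assumes "0 \<le> x"
  shows "x - x\<^sup>2 / 2 \<le> ln (1 + x)"
proof -
  have "ln (1 + 0) - 0 + 0\<^sup>2 / 2 \<le> ln (1 + x) - x + x\<^sup>2 / 2"
  proof (rule DERIV_nonneg_imp_nondecreasing [OF assms])
    fix y :: real assume y: "0 \<le> y"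
    have "((\<lambda>x. ln (1 + x) - x + x\<^sup>2 / 2) has_real_derivative (1 / (1 + y) - 1 + y)) (at y)"
      using y by (auto intro!: derivative_eq_intros)
    moreover have "0 \<le> 1 / (1 + y) - 1 + y"
      using y by (simp add: field_simps)
    ultimately show "\<exists>d. ((\<lambda>x. ln (1 + x) - x + x\<^sup>2 / 2) has_real_derivative d) (at y) \<and> 0 \<le> d"
      by blast
  qed
  then show ?thesis by simp
qed

text \<open>
  The left hand side is the Taylor polynomial at 0, and the sign of the remainder follows from
  that of its derivative. The right hand side is the Chernoff exponent of a Poisson variable.
\<close>

lemma bennett_function_ge:
  fixes x :: real
  assumes "0 \<le> x"
  shows "x\<^sup>2 / 2 - x ^ 3 / 6 \<le> (1 + x) * ln (1 + x) - x"
proof -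
  have "(1 + 0) * ln (1 + 0) - 0 - 0\<^sup>2 / 2 + 0 ^ 3 / 6 \<le> (1 + x) * ln (1 + x) - x - x\<^sup>2 / 2 + x ^ 3 / 6"
  proof (rule DERIV_nonneg_imp_nondecreasing [OF assms])
    fix y :: real assume y: "0 \<le> y"
    have "((\<lambda>x. (1 + x) * ln (1 + x) - x - x\<^sup>2 / 2 + x ^ 3 / 6) has_real_derivative
        (ln (1 + y) - y + y\<^sup>2 / 2)) (at y)"
      using y by (auto intro!: derivative_eq_intros)
    moreover have "0 \<le> ln (1 + y) - y + y\<^sup>2 / 2"
      using ln_one_plus_ge_quadratic [OF y] by simp
    ultimately show "\<exists>d. ((\<lambda>x. (1 + x) * ln (1 + x) - x - x\<^sup>2 / 2 + x ^ 3 / 6)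
        has_real_derivative d) (at y) \<and> 0 \<le> d"
      by blast
  qed
  then show ?thesis by simp
qed

section \<open>Nets of unit balls and quadratic forms\<close>

lemma sum_exp_neg_abs_le:
  fixes h :: real
  assumes "0 < h"
  shows "(\<Sum>j\<in>{- int N..int N}. exp (- h * \<bar>real_of_int j\<bar>)) \<le> 1 + 2 / h"
proof -
  have "(\<Sum>j\<in>{- int N..int N}. exp (- h * \<bar>real_of_int j\<bar>)) \<le> 1 + 2 / h * (1 - exp (- h * real N))"
  proof (induction N)
    case (Suc N)
    have eq: "{- int (Suc N)..int (Suc N)}
        = insert (- int (Suc N)) (insert (int (Suc N)) {- int N..int N})"
      by auto
    have "h * exp (- h) \<le> 1 - exp (- h)"
    proof -
      have "(1 + h) * exp (- h) \<le> exp h * exp (- h)"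
        by (intro mult_right_mono exp_ge_add_one_self) auto
      then show ?thesis
        by (simp add: exp_add [symmetric] algebra_simps)
    qed
    then have "exp (- h) \<le> (1 - exp (- h)) / h"
      using assms by (simp add: field_simps)
    then have "exp (- h * real N) * exp (- h) \<le> exp (- h * real N) * ((1 - exp (- h)) / h)"
      by (intro mult_left_mono) auto
    then have step: "2 * exp (- h * real (Suc N)) \<le> 2 / h * (exp (- h * real N) - exp (- h * real (Suc N)))"
      by (simp add: exp_add [symmetric] algebra_simps diff_divide_distrib)
    have "(\<Sum>j\<in>{- int (Suc N)..int (Suc N)}. exp (- h * \<bar>real_of_int j\<bar>))
        = 2 * exp (- h * real (Suc N)) + (\<Sum>j\<in>{- int N..int N}. exp (- h * \<bar>real_of_int j\<bar>))"
      unfolding eq by (subst sum.insert; simp)+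
    also have "\<dots> \<le> 2 / h * (exp (- h * real N) - exp (- h * real (Suc N)))
        + (1 + 2 / h * (1 - exp (- h * real N)))"
      using step Suc by linarith
    also have "\<dots> = 1 + 2 / h * (1 - exp (- h * real (Suc N)))"
      by (simp add: algebra_simps)
    finally show ?case .
  qed simp
  also have "\<dots> \<le> 1 + 2 / h"
    using assms by (simp add: field_simps)
  finally show ?thesis .
qed

text \<open>
  An exponential weight replaces any volume computation: every point counted has weight
  \<open>exp (card B - h \<Sum>\<bar>k\<^sub>b\<bar>) \<ge> 1\<close>, and the total weight of all lattice points is a product of
  geometric series. Taking h itself as the rate makes each factor at most \<open>e (1 + 2 / h)\<close>.
\<close>

lemma card_lattice_points_l1_le:
  fixes h :: real
  assumes "finite B" and h: "0 < h" "h \<le> 1 / 2"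
  shows "real (card {k \<in> B \<rightarrow>\<^sub>E {- int N..int N}.
            (\<Sum>b\<in>B. \<bar>real_of_int (k b)\<bar>) \<le> real (card B) / h}) \<le> (9 / h) ^ card B"
    (is "real (card ?S) \<le> _")
proof -
  have fin: "finite (B \<rightarrow>\<^sub>E {- int N..int N})"
    using assms by (intro finite_PiE) auto
  have "real (card ?S) = (\<Sum>k\<in>?S. 1)"
    by simp
  also have "\<dots> \<le> (\<Sum>k\<in>?S. \<Prod>b\<in>B. exp 1 * exp (- h * \<bar>real_of_int (k b)\<bar>))"
  proof (intro sum_mono)
    fix k assume "k \<in> ?S"
    then have "h * (\<Sum>b\<in>B. \<bar>real_of_int (k b)\<bar>) \<le> real (card B)"
      using h by (simp add: field_simps)
    then have "0 \<le> (\<Sum>b\<in>B. 1 + - h * \<bar>real_of_int (k b)\<bar>)"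
      by (simp add: sum_subtractf sum_distrib_left)
    then show "1 \<le> (\<Prod>b\<in>B. exp 1 * exp (- h * \<bar>real_of_int (k b)\<bar>))"
      using \<open>finite B\<close> by (simp add: exp_add [symmetric] exp_sum [symmetric])
  qed
  also have "\<dots> \<le> (\<Sum>k\<in>B \<rightarrow>\<^sub>E {- int N..int N}. \<Prod>b\<in>B. exp 1 * exp (- h * \<bar>real_of_int (k b)\<bar>))"
    using fin by (intro sum_mono2 prod_nonneg) auto
  also have "\<dots> = (\<Prod>b\<in>B. \<Sum>j\<in>{- int N..int N}. exp 1 * exp (- h * \<bar>real_of_int j\<bar>))"
    using \<open>finite B\<close> by (subst prod_sum_PiE) auto
  also have "\<dots> \<le> (9 / h) ^ card B"
  proof -
    have "(\<Sum>j\<in>{- int N..int N}. exp 1 * exp (- h * \<bar>real_of_int j\<bar>)) \<le> exp 1 * (1 + 2 / h)"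
      unfolding sum_distrib_left [symmetric]
      using sum_exp_neg_abs_le [OF h(1)] by (intro mult_left_mono) auto
    also have "\<dots> \<le> 3 * (1 + 2 / h)"
      using exp_le h by (intro mult_right_mono) auto
    also have "\<dots> \<le> 9 / h"
      using h by (simp add: field_simps)
    finally show ?thesis
      by (simp add: power_mono sum_nonneg)
  qed
  finally show ?thesis .
qed

text \<open>
  In coordinates with respect to an orthonormal basis, the net consists of the points of the unit
  ball on a grid of width \<open>h / sqrt d\<close>, where d is the dimension. By the Cauchy-Schwarz inequality,
  the integer coordinates k of such a point satisfy \<open>\<Sum>\<bar>k\<^sub>b\<bar> \<le> d / h\<close>, so that the previous
  lemma bounds their number.
\<close>

lemma subspace_unit_ball_net:
  fixes W :: "'a :: euclidean_space set" and h :: real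
  assumes W: "subspace W" and h: "0 < h" "h \<le> 1 / 2"
  obtains T where "finite T" "T \<subseteq> W" "real (card T) \<le> (9 / h) ^ dim W"
    "\<And>y. y \<in> T \<Longrightarrow> norm y \<le> 1"
    "\<And>x. x \<in> W \<Longrightarrow> norm x \<le> 1 \<Longrightarrow> \<exists>y\<in>T. norm (x - y) \<le> h"
proof -
  obtain B where B: "B \<subseteq> W" "pairwise orthogonal B" "\<And>b. b \<in> B \<Longrightarrow> norm b = 1"
      "independent B" "card B = dim W" "span B = W"
    by (metis orthonormal_basis_subspace [OF W])
  have fin: "finite B"
    using B(4) independent_imp_finite by blast
  define d where "d = real (card B)"
  define a where "a = (if card B = 0 then 1 else h / sqrt d)"
  have a: "a > 0" "a * sqrt d \<le> h" "sqrt d / a \<le> d / h"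
    using h by (auto simp: a_def d_def divide_simps)
  have norm_comb: "(norm (\<Sum>b\<in>B. c b *\<^sub>R b))\<^sup>2 = (\<Sum>b\<in>B. (c b)\<^sup>2)" for c
  proof -
    have "(norm (\<Sum>b\<in>B. c b *\<^sub>R b))\<^sup>2 = (\<Sum>b\<in>B. (norm (c b *\<^sub>R b))\<^sup>2)"
      using fin B(2) by (intro norm_sum_Pythagorean)
        (auto simp: pairwise_def orthogonal_clauses)
    then show ?thesis
      using B(3) by simp
  qed
  define N where "N = nat \<lfloor>d / h\<rfloor>"
  define S where "S = {k \<in> B \<rightarrow>\<^sub>E {- int N..int N}. (\<Sum>b\<in>B. \<bar>real_of_int (k b)\<bar>) \<le> d / h}"
  define pt where "pt k = (\<Sum>b\<in>B. (a * real_of_int (k b)) *\<^sub>R b)" for k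
  have finS: "finite S"
    unfolding S_def using fin by (intro finite_subset [OF _ finite_PiE [of B "\<lambda>_. {- int N..int N}"]]) auto
  have cardS: "real (card S) \<le> (9 / h) ^ dim W"
    unfolding S_def d_def using card_lattice_points_l1_le [OF fin h] B(5) by simp
  have cover: "\<exists>y\<in>pt ` S \<inter> cball 0 1. norm (x - y) \<le> h" if x: "x \<in> W" "norm x \<le> 1" for x
  proof -
    obtain c where c: "x = (\<Sum>b\<in>B. c b *\<^sub>R b)"
      using x(1) B(6) span_finite [OF fin] by auto
    have c1: "(\<Sum>b\<in>B. (c b)\<^sup>2) \<le> 1"
      using norm_comb [of c] x(2) power_le_one [of "norm x" 2] by (simp add: c)
    \<comment> \<open>rounding towards zero does not leave the unit ball\<close>
    define k where "k = (\<lambda>b\<in>B. if c b \<ge> 0 then \<lfloor>c b / a\<rfloor> else \<lceil>c b / a\<rceil>)"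
    have k_le: "\<bar>a * real_of_int (k b)\<bar> \<le> \<bar>c b\<bar>"
      and k_err: "\<bar>c b - a * real_of_int (k b)\<bar> \<le> a" if "b \<in> B" for b
    proof -
      define z where "z = c b / a"
      have cz: "c b = a * z" using a(1) by (simp add: z_def)
      have kb: "k b = (if z \<ge> 0 then \<lfloor>z\<rfloor> else \<lceil>z\<rceil>)"
        using that a(1) by (simp add: k_def z_def zero_le_divide_iff)
      have "\<bar>real_of_int (k b)\<bar> \<le> \<bar>z\<bar> \<and> \<bar>z - real_of_int (k b)\<bar> \<le> 1"
      proof (cases "z \<ge> 0")
        case True
        then have "0 \<le> real_of_int \<lfloor>z\<rfloor>" "k b = \<lfloor>z\<rfloor>"
          using kb by simp_all
        then show ?thesis
          using floor_correct [of z] by linarith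
      next
        case False
        then have "real_of_int \<lceil>z\<rceil> \<le> 0" "k b = \<lceil>z\<rceil>"
          using kb by simp_all
        then show ?thesis
          using ceiling_correct [of z] by linarith
      qed
      then have "a * \<bar>real_of_int (k b)\<bar> \<le> a * \<bar>z\<bar>" "a * \<bar>z - real_of_int (k b)\<bar> \<le> a * 1"
        using a(1) by (auto intro: mult_left_mono)
      moreover have "c b - a * real_of_int (k b) = a * (z - real_of_int (k b))"
        by (simp add: cz right_diff_distrib)
      ultimately show "\<bar>a * real_of_int (k b)\<bar> \<le> \<bar>c b\<bar>" "\<bar>c b - a * real_of_int (k b)\<bar> \<le> a"
        using a(1) by (simp_all add: cz abs_mult)
    qed
    have sq: "(\<Sum>b\<in>B. (a * real_of_int (k b))\<^sup>2) \<le> 1"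
    proof -
      have "(\<Sum>b\<in>B. (a * real_of_int (k b))\<^sup>2) \<le> (\<Sum>b\<in>B. (c b)\<^sup>2)"
        by (intro sum_mono abs_le_square_iff [THEN iffD1] k_le)
      then show ?thesis using c1 by linarith
    qed
    have "(\<Sum>b\<in>B. \<bar>real_of_int (k b)\<bar> * 1)
        \<le> L2_set (\<lambda>b. real_of_int (k b)) B * L2_set (\<lambda>b. 1) B"
      using L2_set_mult_ineq [of "\<lambda>b. real_of_int (k b)" "\<lambda>b. 1" B] by simp
    moreover have "a\<^sup>2 * (\<Sum>b\<in>B. (real_of_int (k b))\<^sup>2) \<le> 1"
      using sq by (simp add: power_mult_distrib sum_distrib_left)
    then have "(\<Sum>b\<in>B. (real_of_int (k b))\<^sup>2) \<le> (1 / a)\<^sup>2"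
      using a(1) by (simp add: field_simps)
    then have "L2_set (\<lambda>b. real_of_int (k b)) B \<le> 1 / a"
      unfolding L2_set_def using a(1) by (intro real_le_lsqrt) auto
    then have "L2_set (\<lambda>b. real_of_int (k b)) B * L2_set (\<lambda>b. 1) B \<le> 1 / a * sqrt d"
      using a(1) by (intro mult_mono) (simp_all add: L2_set_def d_def sum_nonneg)
    ultimately have l1: "(\<Sum>b\<in>B. \<bar>real_of_int (k b)\<bar>) \<le> d / h"
      using a(3) by simp
    have "k b \<in> {- int N..int N}" if "b \<in> B" for b
    proof -
      have "\<bar>real_of_int (k b)\<bar> \<le> d / h"
        using l1 member_le_sum [of b B "\<lambda>b. \<bar>real_of_int (k b)\<bar>"] fin that by simp
      then have "\<bar>k b\<bar> \<le> \<lfloor>d / h\<rfloor>"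
        by (simp add: le_floor_iff)
      moreover have "0 \<le> \<lfloor>d / h\<rfloor>"
        using h(1) by (simp add: d_def)
      ultimately show ?thesis
        unfolding N_def atLeastAtMost_iff by linarith
    qed
    then have "k \<in> S"
      using l1 unfolding S_def k_def by auto
    moreover have "norm (pt k) \<le> 1"
    proof -
      have "(norm (pt k))\<^sup>2 \<le> 1"
        using sq norm_comb [of "\<lambda>b. a * real_of_int (k b)"] by (simp add: pt_def)
      then show ?thesis by (simp add: abs_square_le_1)
    qed
    moreover have "norm (x - pt k) \<le> h"
    proof -
      have "x - pt k = (\<Sum>b\<in>B. (c b - a * real_of_int (k b)) *\<^sub>R b)"
        unfolding c pt_def by (simp add: sum_subtractf scaleR_diff_left)
      then have "(norm (x - pt k))\<^sup>2 = (\<Sum>b\<in>B. (c b - a * real_of_int (k b))\<^sup>2)"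
        using norm_comb by simp
      also have "\<dots> \<le> (\<Sum>b\<in>B. a\<^sup>2)"
        using k_err a(1) by (intro sum_mono abs_le_square_iff [THEN iffD1]) simp
      also have "\<dots> = (a * sqrt d)\<^sup>2"
        by (simp add: d_def power_mult_distrib)
      also have "\<dots> \<le> h\<^sup>2"
        using a by (intro power_mono) (auto simp: d_def)
      finally show ?thesis
        using h(1) by (simp add: power2_le_iff_abs_le)
    qed
    ultimately show ?thesis by auto
  qed
  show ?thesis
  proof
    show "finite (pt ` S \<inter> cball 0 1)" using finS by auto
    show "pt ` S \<inter> cball 0 1 \<subseteq> W"
      using B(1) W by (auto simp: pt_def intro!: subspace_sum subspace_scale)
    have "card (pt ` S \<inter> cball 0 1) \<le> card S"
      by (meson card_image_le card_mono finS finite_imageI inf_le1 le_trans)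
    then show "real (card (pt ` S \<inter> cball 0 1)) \<le> (9 / h) ^ dim W"
      using cardS by linarith
  qed (use cover in auto)
qed

text \<open>
  Let E be the maximum of the absolute value of the quadratic form q on the unit ball of W,
  attained at z, and let y be a net point near z. Then \<open>q z - q y\<close> is the polar form of q at
  \<open>z - y\<close> and \<open>z + y\<close>, hence at most \<open>2 h E\<close>, and so \<open>E \<le> e + 2 h E\<close>.
\<close>

lemma quadratic_form_bound_from_net:
  fixes L :: "'a :: euclidean_space \<Rightarrow> 'b :: real_inner" and e g h :: real
  assumes W: "subspace W" and L: "linear L" and h: "0 < h" "h < 1 / 2"
    and T: "T \<subseteq> W" "\<And>y. y \<in> T \<Longrightarrow> norm y \<le> 1"
      "\<And>x. x \<in> W \<Longrightarrow> norm x \<le> 1 \<Longrightarrow> \<exists>y\<in>T. norm (x - y) \<le> h"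
    and e: "0 \<le> e"
    and q_T: "\<And>y. y \<in> T \<Longrightarrow> \<bar>(norm (L y))\<^sup>2 - g * (norm y)\<^sup>2\<bar> \<le> e * (norm y)\<^sup>2"
    and x: "x \<in> W"
  shows "\<bar>(norm (L x))\<^sup>2 - g * (norm x)\<^sup>2\<bar> \<le> e / (1 - 2 * h) * (norm x)\<^sup>2"
proof -
  interpret linear L by fact
  define q where "q x = (norm (L x))\<^sup>2 - g * (norm x)\<^sup>2" for x
  define D where "D = W \<inter> cball 0 1"
  have q_scale: "q (c *\<^sub>R z) = c\<^sup>2 * q z" for c z
    by (simp add: q_def scale power_mult_distrib algebra_simps)
  have "continuous_on D (\<lambda>x. \<bar>q x\<bar>)"
    unfolding q_def
    by (intro continuous_intros linear_continuous_on linear_conv_bounded_linear [THEN iffD1] L)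
  moreover have "compact D"
    unfolding D_def using closed_subspace [OF W] by (intro closed_Int_compact) auto
  moreover have "0 \<in> D"
    using subspace_0 [OF W] by (simp add: D_def)
  ultimately obtain z where z: "z \<in> D" "\<And>y. y \<in> D \<Longrightarrow> \<bar>q y\<bar> \<le> \<bar>q z\<bar>"
    using continuous_attains_sup [of D "\<lambda>x. \<bar>q x\<bar>"] by blast
  define E where "E = \<bar>q z\<bar>"
  have E: "\<bar>q y\<bar> \<le> E * (norm y)\<^sup>2" if "y \<in> W" for y
  proof (cases "y = 0")
    case False
    have "(1 / norm y) *\<^sub>R y \<in> D"
      using that W False by (auto simp: D_def intro: subspace_scale)
    then have "\<bar>(1 / norm y)\<^sup>2 * q y\<bar> \<le> E"
      using z(2) q_scale unfolding E_def by metis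
    then show ?thesis
      using False by (simp add: abs_mult field_simps)
  qed (simp add: q_def zero)
  obtain y where y: "y \<in> T" "norm (z - y) \<le> h"
    using T(3) z(1) unfolding D_def by auto
  have zW: "z \<in> W" "norm z \<le> 1" and yW: "y \<in> W" "norm y \<le> 1"
    using z(1) y(1) T unfolding D_def by auto
  define u where "u = (1 / h) *\<^sub>R (z - y)"
  define v where "v = (1 / 2) *\<^sub>R (z + y)"
  have uv: "u \<in> W" "v \<in> W"
    unfolding u_def v_def using W zW yW by (auto intro: subspace_scale subspace_diff subspace_add)
  have nu: "norm u \<le> 1" using y(2) h by (simp add: u_def)
  have nv: "norm v \<le> 1"
    using zW(2) yW(2) norm_triangle_ineq [of z y] by (simp add: v_def)
  have zy: "z - y = h *\<^sub>R u" "z + y = 2 *\<^sub>R v"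
    using h by (auto simp: u_def v_def)
  \<comment> \<open>this expresses the polar form by values of q, so that bounds on q transfer to it\<close>
  have pol: "q (a + b) - q (a - b) = 4 * (L a \<bullet> L b - g * (a \<bullet> b))" for a b
    by (simp add: q_def add diff power2_norm_eq_inner algebra_simps inner_commute)
  have "q z - q y = L (z - y) \<bullet> L (z + y) - g * ((z - y) \<bullet> (z + y))"
    by (simp add: q_def add diff power2_norm_eq_inner algebra_simps inner_commute)
  also have "\<dots> = h / 2 * (q (u + v) - q (u - v))"
    unfolding zy pol by (simp add: scale algebra_simps)
  finally have diff: "q z - q y = h / 2 * (q (u + v) - q (u - v))" .
  have "\<bar>q (u + v) - q (u - v)\<bar> \<le> E * (norm (u + v))\<^sup>2 + E * (norm (u - v))\<^sup>2"
    using E [of "u + v"] E [of "u - v"] uv W subspace_add subspace_diff by fastforce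
  also have "\<dots> = 2 * E * ((norm u)\<^sup>2 + (norm v)\<^sup>2)"
    by (simp add: power2_norm_eq_inner algebra_simps inner_commute)
  also have "\<dots> \<le> 2 * E * (1 + 1)"
    using nu nv by (intro mult_left_mono add_mono power_le_one) (auto simp: E_def)
  finally have "\<bar>q z - q y\<bar> \<le> h / 2 * (4 * E)"
    unfolding diff abs_mult using h by (intro mult_mono) auto
  moreover have "\<bar>q y\<bar> \<le> e"
  proof -
    have "\<bar>q y\<bar> \<le> e * (norm y)\<^sup>2" using q_T y(1) by (simp add: q_def)
    also have "\<dots> \<le> e * 1" using e yW(2) by (intro mult_left_mono power_le_one) auto
    finally show ?thesis by simp
  qed
  ultimately have "E \<le> e + 2 * h * E"
    unfolding E_def by argo
  then have "E \<le> e / (1 - 2 * h)"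
    using h by (simp add: field_simps)
  then have "E * (norm x)\<^sup>2 \<le> e / (1 - 2 * h) * (norm x)\<^sup>2"
    by (intro mult_right_mono) auto
  then show ?thesis
    using E [OF x] unfolding q_def by linarith
qed

section \<open>From single matrices to the sketched minimizer\<close>

lemma sketched_minimizer_quasi_optimal:
  fixes B :: "real ^ 'n ^ 'n" and V :: "real ^ 'k ^ 'n" and g e :: real
  assumes Y: "subspace Y" and g: "0 < g" and e: "0 \<le> e" "e < 1"
    and emb: "\<And>P. P \<in> Y \<Longrightarrow>
      \<bar>(norm ((mat 1 - P ** B) ** V))\<^sup>2 - g * (norm (mat 1 - P ** B))\<^sup>2\<bar>
        \<le> g * e * (norm (mat 1 - P ** B))\<^sup>2"
    and min: "sketched_minimizer B V Y P"
  shows "norm (mat 1 - P ** B) \<le> sqrt ((1 + e) / (1 - e)) * (INF Q\<in>Y. norm (mat 1 - Q ** B))"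
proof -
  define c where "c = sqrt ((1 + e) / (1 - e))"
  have c: "c > 0" using e by (simp add: c_def)
  have P: "P \<in> Y" and le: "\<And>Q. Q \<in> Y \<Longrightarrow> norm ((mat 1 - P ** B) ** V) \<le> norm ((mat 1 - Q ** B) ** V)"
    using min unfolding sketched_minimizer_def is_arg_min_linorder by auto
  have "norm (mat 1 - P ** B) / c \<le> norm (mat 1 - Q ** B)" if Q: "Q \<in> Y" for Q
  proof -
    have "g * ((1 - e) * (norm (mat 1 - P ** B))\<^sup>2) \<le> (norm ((mat 1 - P ** B) ** V))\<^sup>2"
      using emb [OF P] by (simp add: algebra_simps abs_le_iff)
    also have "\<dots> \<le> (norm ((mat 1 - Q ** B) ** V))\<^sup>2"
      using le [OF Q] by (intro power_mono) auto
    also have "\<dots> \<le> g * ((1 + e) * (norm (mat 1 - Q ** B))\<^sup>2)"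
      using emb [OF Q] by (simp add: algebra_simps abs_le_iff)
    finally have "(1 - e) * (norm (mat 1 - P ** B))\<^sup>2 \<le> (1 + e) * (norm (mat 1 - Q ** B))\<^sup>2"
      using g by simp
    then have "(norm (mat 1 - P ** B))\<^sup>2 \<le> (1 + e) / (1 - e) * (norm (mat 1 - Q ** B))\<^sup>2"
      using e by (simp add: field_simps)
    also have "\<dots> = (c * norm (mat 1 - Q ** B))\<^sup>2"
      using e by (simp add: c_def power_mult_distrib)
    finally have "norm (mat 1 - P ** B) \<le> c * norm (mat 1 - Q ** B)"
      using c by (simp add: power2_le_iff_abs_le)
    then show ?thesis using c by (simp add: field_simps)
  qed
  then have "norm (mat 1 - P ** B) / c \<le> (INF Q\<in>Y. norm (mat 1 - Q ** B))"
    using P by (intro cINF_greatest) auto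
  then show ?thesis
    using c unfolding c_def [symmetric] by (simp add: field_simps)
qed

lemma linear_matrix_mult_right: "linear (\<lambda>X :: real ^ 'm ^ 'n. X ** (V :: real ^ 'k ^ 'm))"
  by (intro linearI)
    (simp_all add: matrix_matrix_mult_def vec_eq_iff sum.distrib sum_distrib_left algebra_simps)

text \<open>
  The residuals form an affine family; adjoining the identity to the spanning set makes it part
  of a linear subspace at the price of one dimension.
\<close>

lemma residual_subspace:
  fixes B :: "real ^ 'n ^ 'n" and Ps :: "nat \<Rightarrow> real ^ 'n ^ 'n"
  obtains W where "subspace W" "dim W \<le> m + 1"
    "\<And>P. P \<in> span (Ps ` {1..m}) \<Longrightarrow> mat 1 - P ** B \<in> W"
proof
  let ?S = "insert (mat 1) ((\<lambda>i. Ps i ** B) ` {1..m})"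
  show "subspace (span ?S)" by simp
  have "dim (span ?S) \<le> card ?S"
    by (simp add: dim_le_card')
  also have "\<dots> \<le> Suc (card ((\<lambda>i. Ps i ** B) ` {1..m}))"
    by (simp add: card_insert_le_m1)
  also have "\<dots> \<le> m + 1"
    using card_image_le [of "{1..m}" "\<lambda>i. Ps i ** B"] by simp
  finally show "dim (span ?S) \<le> m + 1" .
  fix P assume "P \<in> span (Ps ` {1..m})"
  then have "P ** B \<in> (\<lambda>X. X ** B) ` span (Ps ` {1..m})"
    by blast
  also have "\<dots> = span ((\<lambda>i. Ps i ** B) ` {1..m})"
    by (subst linear_span_image [OF linear_matrix_mult_right, symmetric]) (simp add: image_image)
  also have "\<dots> \<subseteq> span ?S"
    by (intro span_mono) auto
  finally show "mat 1 - P ** B \<in> span ?S"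
    by (intro span_diff [OF span_base]) simp
qed

lemma embedding_failure_prob_scale:
  fixes law :: "(real ^ 'k ^ 'n) pmf" and M :: "real ^ 'n ^ 'n" and g e p :: real
  assumes p: "0 \<le> p" and fail: "\<And>M :: real ^ 'n ^ 'n. norm M = 1 \<Longrightarrow>
      measure_pmf.prob law {V. \<bar>(norm (M ** V))\<^sup>2 - g\<bar> > e} \<le> p"
  shows "measure_pmf.prob law {V. \<bar>(norm (M ** V))\<^sup>2 - g * (norm M)\<^sup>2\<bar> > e * (norm M)\<^sup>2} \<le> p"
proof (cases "M = 0")
  case True
  then show ?thesis
    using p linear_0 [OF linear_matrix_mult_right] by auto
next
  case False
  define M1 where "M1 = (1 / norm M) *\<^sub>R M"
  have M: "M = norm M *\<^sub>R M1" and n: "norm M1 = 1"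
    using False by (simp_all add: M1_def)
  have "norm (M ** V) = norm M * norm (M1 ** V)" for V :: "real ^ 'k ^ 'n"
    using linear_scale [OF linear_matrix_mult_right, of "norm M" M1 V] M by simp
  then have "(norm (M ** V))\<^sup>2 - g * (norm M)\<^sup>2 = (norm M)\<^sup>2 * ((norm (M1 ** V))\<^sup>2 - g)"
    for V :: "real ^ 'k ^ 'n"
    by (simp only: power_mult_distrib right_diff_distrib mult.commute)
  then have "\<bar>(norm (M ** V))\<^sup>2 - g * (norm M)\<^sup>2\<bar> > e * (norm M)\<^sup>2
      \<longleftrightarrow> \<bar>(norm (M1 ** V))\<^sup>2 - g\<bar> > e" for V :: "real ^ 'k ^ 'n"
    using False by (simp add: abs_mult mult.commute [of e])
  then show ?thesis
    using fail [OF n] by simp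
qed

text \<open>
  The union bound over a net of mesh \<open>1 / (C + 1)\<close>. This mesh is the one for which
  \<open>\<epsilon> / (1 - 2 h)\<close> equals \<open>\<epsilon>'\<close>. It does not depend on \<open>\<epsilon>\<close>, but the condition \<open>\<epsilon>' < 1\<close> forces
  \<open>\<epsilon> (C + 1) \<le> C\<close>, which brings the size of the net below \<open>(9 C / \<epsilon>) ^ (m + 1)\<close>.
\<close>

lemma quasi_optimality_from_pointwise_embedding:
  fixes B :: "real ^ 'n ^ 'n" and Ps :: "nat \<Rightarrow> real ^ 'n ^ 'n" and law :: "(real ^ 'k ^ 'n) pmf"
    and g p \<delta> \<epsilon> \<epsilon>' C :: real
  assumes g: "0 < g" and \<epsilon>: "0 < \<epsilon>" and C: "1 < C"
    and \<epsilon>': "\<epsilon>' = \<epsilon> * (C + 1) / (C - 1)" "\<epsilon>' < 1"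
    and p: "0 \<le> p" "(9 * C / \<epsilon>) ^ (m + 1) * p \<le> \<delta>"
    and fail: "\<And>M :: real ^ 'n ^ 'n. norm M = 1 \<Longrightarrow>
      measure_pmf.prob law {V. \<bar>(norm (M ** V))\<^sup>2 - g\<bar> > g * \<epsilon>} \<le> p"
  shows "1 - \<delta> \<le> measure_pmf.prob law
           {V. \<forall>P. sketched_minimizer B V (span (Ps ` {1..m})) P \<longrightarrow>
                 norm (mat 1 - P ** B)
                   \<le> sqrt ((1 + \<epsilon>') / (1 - \<epsilon>'))
                      * (INF Q\<in>span (Ps ` {1..m}). norm (mat 1 - Q ** B))}"
    (is "_ \<le> measure_pmf.prob law ?Good")
proof -
  define Good where "Good = ?Good"
  have \<epsilon>'0: "0 \<le> \<epsilon>'"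
    using \<epsilon> C by (simp add: \<epsilon>'(1))
  obtain W where W: "subspace W" "dim W \<le> m + 1"
    "\<And>P. P \<in> span (Ps ` {1..m}) \<Longrightarrow> mat 1 - P ** B \<in> W"
    using residual_subspace by blast
  define h where "h = 1 / (C + 1)"
  have h: "0 < h" "h < 1 / 2" using C by (auto simp: h_def field_simps)
  have \<epsilon>'_h: "g * \<epsilon> / (1 - 2 * h) = g * \<epsilon>'"
    using C unfolding \<epsilon>' h_def by (simp add: field_simps)
  obtain T where T: "finite T" "T \<subseteq> W" "real (card T) \<le> (9 / h) ^ dim W"
    "\<And>y. y \<in> T \<Longrightarrow> norm y \<le> 1"
    "\<And>x. x \<in> W \<Longrightarrow> norm x \<le> 1 \<Longrightarrow> \<exists>y\<in>T. norm (x - y) \<le> h"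
    using subspace_unit_ball_net [OF W(1) h(1) less_imp_le [OF h(2)]] by blast
  have "9 / h \<le> 9 * C / \<epsilon>"
  proof -
    have "\<epsilon> * (C + 1) < C - 1"
      using \<epsilon>'(2) C unfolding \<epsilon>'(1) by (simp add: divide_less_eq)
    then have "\<epsilon> * (C + 1) \<le> C" by simp
    then show ?thesis using \<epsilon> by (simp add: h_def field_simps)
  qed
  moreover have "1 \<le> 9 / h" using h by (simp add: field_simps)
  ultimately have cardT: "real (card T) \<le> (9 * C / \<epsilon>) ^ (m + 1)"
    using T(3) power_increasing [OF W(2), of "9 / h"] power_mono [of "9 / h" "9 * C / \<epsilon>" "m + 1"] h(1)
    by (meson divide_nonneg_pos order_trans zero_le_numeral)
  define Bad :: "real ^ 'n ^ 'n \<Rightarrow> (real ^ 'k ^ 'n) set"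
    where "Bad M = {V. \<bar>(norm (M ** V))\<^sup>2 - g * (norm M)\<^sup>2\<bar> > g * \<epsilon> * (norm M)\<^sup>2}" for M
  have "- Good \<subseteq> (\<Union>M\<in>T. Bad M)"
  proof
    fix V assume V: "V \<in> - Good"
    show "V \<in> (\<Union>M\<in>T. Bad M)"
    proof (rule ccontr)
      assume "V \<notin> (\<Union>M\<in>T. Bad M)"
      then have net: "\<And>M. M \<in> T \<Longrightarrow> \<bar>(norm (M ** V))\<^sup>2 - g * (norm M)\<^sup>2\<bar> \<le> g * \<epsilon> * (norm M)\<^sup>2"
        by (auto simp: Bad_def not_less)
      have "\<bar>(norm (M ** V))\<^sup>2 - g * (norm M)\<^sup>2\<bar> \<le> g * \<epsilon>' * (norm M)\<^sup>2" if "M \<in> W" for M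
      proof -
        have ge: "0 \<le> g * \<epsilon>" using g \<epsilon> by simp
        show ?thesis
          using quadratic_form_bound_from_net
            [OF W(1) linear_matrix_mult_right h T(2) T(4) T(5) ge net that]
          unfolding \<epsilon>'_h .
      qed
      then have emb: "\<And>P. P \<in> span (Ps ` {1..m}) \<Longrightarrow>
          \<bar>(norm ((mat 1 - P ** B) ** V))\<^sup>2 - g * (norm (mat 1 - P ** B))\<^sup>2\<bar>
            \<le> g * \<epsilon>' * (norm (mat 1 - P ** B))\<^sup>2"
        using W(3) by blast
      have "V \<in> Good"
        unfolding Good_def using sketched_minimizer_quasi_optimal [OF subspace_span g \<epsilon>'0 \<epsilon>'(2) emb] by blast
      then show False using V by simp
    qed
  qed
  then have "measure_pmf.prob law (- Good) \<le> measure_pmf.prob law (\<Union>M\<in>T. Bad M)"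
    by (intro measure_pmf.finite_measure_mono) auto
  also have "\<dots> \<le> (\<Sum>M\<in>T. measure_pmf.prob law (Bad M))"
    using T(1) by (intro measure_pmf.finite_measure_subadditive_finite) auto
  also have "\<dots> \<le> (\<Sum>M\<in>T. p)"
    unfolding Bad_def using embedding_failure_prob_scale [OF p(1) fail] by (intro sum_mono) blast
  also have "\<dots> \<le> (9 * C / \<epsilon>) ^ (m + 1) * p"
    using mult_right_mono [OF cardT p(1)] by simp
  also have "\<dots> \<le> \<delta>" by (fact p)
  finally have "measure_pmf.prob law (- Good) \<le> \<delta>" .
  moreover have "measure_pmf.prob law (- Good) = 1 - measure_pmf.prob law Good"
    using measure_pmf.prob_compl [of Good law] by (simp only: Compl_eq_Diff_UNIV) simp
  ultimately show ?thesis
    unfolding Good_def by linarith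
qed

section \<open>Exponential moments of Rademacher sums\<close>

text \<open>
  Markov's inequality in the form in which Chernoff bounds use it: f is an exponential that
  dominates the indicator function of S.
\<close>

lemma prob_le_expectation:
  fixes f :: "'a \<Rightarrow> real"
  assumes "finite (set_pmf p)" and "\<And>x. 0 \<le> f x" and "\<And>x. x \<in> set_pmf p \<Longrightarrow> x \<in> S \<Longrightarrow> 1 \<le> f x"
  shows "measure_pmf.prob p S \<le> measure_pmf.expectation p f"
proof -
  have "measure_pmf.prob p S = measure_pmf.expectation p (indicator S)"
    by simp
  also have "\<dots> \<le> measure_pmf.expectation p f"
    using assms by (intro integral_mono_AE integrable_measure_pmf_finite)
      (auto simp: AE_measure_pmf_iff indicator_def)
  finally show ?thesis .
qed

lemma expectation_rademacher:
  fixes f :: "real \<Rightarrow> real"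
  shows "measure_pmf.expectation rademacher_pmf f = (f 1 + f (- 1)) / 2"
  unfolding rademacher_pmf_def by (subst integral_pmf_of_set) auto

lemma set_rademacher_pmf [simp]: "set_pmf rademacher_pmf = {-1, 1}"
  by (simp add: rademacher_pmf_def)

lemma pmf_rademacher [simp]: "pmf rademacher_pmf 1 = 1 / 2" "pmf rademacher_pmf (- 1) = 1 / 2"
  by (simp_all add: rademacher_pmf_def)

text \<open>
  The hyperbolic cosine as the moment generating function of a sign; the estimate is Hoeffding's
  lemma for the uniform distribution on two points.
\<close>

lemma exp_plus_exp_minus_le: "(exp a + exp (- a)) / 2 \<le> exp (a\<^sup>2 / 2)" for a :: real
proof -
  have *: "(exp a + exp (- a)) / 2 \<le> exp (a\<^sup>2 / 2)" if "a > 0" for a :: real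
  proof -
    have "ln ((1 + exp (2 * a)) / 2) \<le> a + a\<^sup>2 / 2"
      using Hoeffdings_lemma_aux [of "2 * a" "1 / 2"] that
      by (simp add: power_mult_distrib field_simps)
    moreover have "0 < (1 + exp (2 * a)) / 2"
      by (simp add: add_pos_pos)
    ultimately have "(1 + exp (2 * a)) / 2 \<le> exp (a + a\<^sup>2 / 2)"
      by (metis exp_le_cancel_iff exp_ln)
    then have "(1 + exp (2 * a)) / 2 * exp (- a) \<le> exp (a + a\<^sup>2 / 2) * exp (- a)"
      by (intro mult_right_mono) auto
    then show ?thesis
      by (simp add: exp_add [symmetric] distrib_right add_divide_distrib)
  qed
  show ?thesis
    using * [of a] * [of "- a"] by (cases a "0 :: real" rule: linorder_cases) (auto simp: add.commute)
qed

abbreviation signs_pmf :: "'i set \<Rightarrow> ('i \<Rightarrow> real) pmf" where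
  "signs_pmf I \<equiv> Pi_pmf I 0 (\<lambda>_. rademacher_pmf)"

lemma finite_set_signs_pmf [simp]: "finite I \<Longrightarrow> finite (set_pmf (signs_pmf I))"
  by (auto simp: set_Pi_pmf intro!: finite_PiE_dflt)

lemma expectation_signs_insert:
  fixes f :: "('i \<Rightarrow> real) \<Rightarrow> real"
  assumes "finite I" "i \<notin> I"
  shows "measure_pmf.expectation (signs_pmf (insert i I)) f
    = (measure_pmf.expectation (signs_pmf I) (\<lambda>x. f (x(i := 1)))
      + measure_pmf.expectation (signs_pmf I) (\<lambda>x. f (x(i := - 1)))) / 2"
proof -
  have "signs_pmf (insert i I) = rademacher_pmf \<bind> (\<lambda>y. map_pmf (\<lambda>x. x(i := y)) (signs_pmf I))"
    using assms by (simp add: Pi_pmf_insert' map_pmf_def)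
  then show ?thesis
    using assms by (simp only:, subst pmf_expectation_bind [of "{-1, 1}"]) (auto simp: field_simps)
qed

lemma expectation_signs_exp_le:
  assumes "finite I"
  shows "measure_pmf.expectation (signs_pmf I) (\<lambda>x. exp (\<Sum>i\<in>I. c i * x i)) \<le> exp ((\<Sum>i\<in>I. (c i)\<^sup>2) / 2)"
proof -
  have "measure_pmf.expectation (signs_pmf I) (\<lambda>x. exp (\<Sum>i\<in>I. c i * x i))
      = measure_pmf.expectation (signs_pmf I) (\<lambda>x. \<Prod>i\<in>I. exp (c i * x i))"
    using assms by (simp add: exp_sum)
  also have "\<dots> = (\<Prod>i\<in>I. (exp (c i) + exp (- c i)) / 2)"
    using assms by (subst expectation_prod_Pi_pmf)
      (auto simp: expectation_rademacher intro: integrable_measure_pmf_finite)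
  also have "\<dots> \<le> (\<Prod>i\<in>I. exp ((c i)\<^sup>2 / 2))"
    by (intro prod_mono conjI exp_plus_exp_minus_le) auto
  also have "\<dots> = exp ((\<Sum>i\<in>I. (c i)\<^sup>2) / 2)"
    using assms by (simp add: exp_sum sum_divide_distrib)
  finally show ?thesis .
qed

lemma has_integral_std_normal_exp:
  fixes b :: real
  shows "has_bochner_integral lborel (\<lambda>z. std_normal_density z * exp (b * z)) (exp (b\<^sup>2 / 2))"
proof -
  have "std_normal_density z * exp (b * z) = exp (b\<^sup>2 / 2) * normal_density b 1 z" for z
    by (simp add: normal_density_def exp_add [symmetric] power2_eq_square field_simps)
  moreover have "has_bochner_integral lborel (\<lambda>z. exp (b\<^sup>2 / 2) * normal_density b 1 z) (exp (b\<^sup>2 / 2) * 1)"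
    by (intro has_bochner_integral_mult_right) (auto simp: has_bochner_integral_iff)
  ultimately show ?thesis by simp
qed

lemma has_integral_std_normal_exp_square:
  fixes t :: real
  assumes "2 * t < 1"
  shows "has_bochner_integral lborel (\<lambda>z. std_normal_density z * exp (t * z\<^sup>2)) (1 / sqrt (1 - 2 * t))"
proof -
  define \<sigma> where "\<sigma> = 1 / sqrt (1 - 2 * t)"
  have \<sigma>: "\<sigma> > 0" "\<sigma>\<^sup>2 = 1 / (1 - 2 * t)" using assms by (auto simp: \<sigma>_def power_divide)
  have "std_normal_density z * exp (t * z\<^sup>2) = \<sigma> * normal_density 0 \<sigma> z" for z
  proof -
    have "- z\<^sup>2 / 2 + t * z\<^sup>2 = - z\<^sup>2 / (2 * \<sigma>\<^sup>2)"
      using assms unfolding \<sigma> by (simp add: field_simps)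
    then have "exp (- z\<^sup>2 / 2) * exp (t * z\<^sup>2) = exp (- z\<^sup>2 / (2 * \<sigma>\<^sup>2))"
      by (simp only: exp_add [symmetric])
    moreover have "\<sigma> * (1 / sqrt (2 * pi * \<sigma>\<^sup>2)) = 1 / sqrt (2 * pi)"
      using \<sigma>(1) by (simp add: real_sqrt_mult)
    ultimately show ?thesis
      unfolding std_normal_density_def unfolding normal_density_def
      by (metis (no_types, lifting) diff_0_right mult.assoc)
  qed
  moreover have "has_bochner_integral lborel (\<lambda>z. \<sigma> * normal_density 0 \<sigma> z) (\<sigma> * 1)"
    using \<sigma> by (intro has_bochner_integral_mult_right) (auto simp: has_bochner_integral_iff)
  ultimately show ?thesis by (simp add: \<sigma>_def)
qed

text \<open>
  For a standard Gaussian z independent of x, \<open>exp (t y\<^sup>2)\<close> is the expectation of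
  \<open>exp (sqrt (2 t) y z)\<close> over z. After exchanging the two expectations, the square in the exponent
  is gone and the sub-Gaussian bound for linear forms in x applies; the remaining expectation
  of \<open>exp (t z\<^sup>2)\<close> over z is the right hand side.
\<close>

lemma expectation_signs_exp_square_le:
  assumes I: "finite I" and t: "0 \<le> t" "2 * t < 1" and u: "(\<Sum>i\<in>I. (u i)\<^sup>2) \<le> 1"
  shows "measure_pmf.expectation (signs_pmf I) (\<lambda>x. exp (t * (\<Sum>i\<in>I. u i * x i)\<^sup>2)) \<le> 1 / sqrt (1 - 2 * t)"
proof -
  define X where "X = set_pmf (signs_pmf I)"
  define w where "w = pmf (signs_pmf I)"
  define y where "y x = (\<Sum>i\<in>I. u i * x i)" for x
  define b where "b = sqrt (2 * t)"
  have X: "finite X" using I by (simp add: X_def)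
  have E: "measure_pmf.expectation (signs_pmf I) f = (\<Sum>x\<in>X. f x * w x)" for f :: "_ \<Rightarrow> real"
    unfolding X_def w_def using I by (intro integral_measure_pmf_real) auto
  have int: "has_bochner_integral lborel (\<lambda>z. std_normal_density z * exp (b * y x * z)) (exp (t * (y x)\<^sup>2))" for x
    using has_integral_std_normal_exp [of "b * y x"] t by (simp add: b_def power_mult_distrib)
  have sum: "has_bochner_integral lborel
      (\<lambda>z. \<Sum>x\<in>X. std_normal_density z * exp (b * y x * z) * w x) (\<Sum>x\<in>X. exp (t * (y x)\<^sup>2) * w x)"
    by (intro has_bochner_integral_sum has_bochner_integral_mult_left) (rule int)
  have "(\<Sum>x\<in>X. exp (t * (y x)\<^sup>2) * w x)
      = (\<integral>z. (\<Sum>x\<in>X. std_normal_density z * exp (b * y x * z) * w x) \<partial>lborel)"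
    using sum by (simp add: has_bochner_integral_iff)
  also have "\<dots> \<le> (\<integral>z. std_normal_density z * exp (t * z\<^sup>2) \<partial>lborel)"
  proof (intro integral_mono)
    fix z :: real
    have "(\<Sum>x\<in>X. exp (b * y x * z) * w x)
        = measure_pmf.expectation (signs_pmf I) (\<lambda>x. exp (\<Sum>i\<in>I. b * z * u i * x i))"
      unfolding E y_def by (simp add: sum_distrib_left mult_ac)
    also have "\<dots> \<le> exp ((\<Sum>i\<in>I. (b * z * u i)\<^sup>2) / 2)"
      by (rule expectation_signs_exp_le [OF I])
    also have "(\<Sum>i\<in>I. (b * z * u i)\<^sup>2) / 2 = t * z\<^sup>2 * (\<Sum>i\<in>I. (u i)\<^sup>2)"
      using t by (simp add: b_def power_mult_distrib sum_distrib_left sum_divide_distrib mult_ac)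
    also have "exp \<dots> \<le> exp (t * z\<^sup>2)"
      using t u by (simp add: mult_left_le)
    finally have "std_normal_density z * (\<Sum>x\<in>X. exp (b * y x * z) * w x)
        \<le> std_normal_density z * exp (t * z\<^sup>2)"
      by (intro mult_left_mono) auto
    then show "(\<Sum>x\<in>X. std_normal_density z * exp (b * y x * z) * w x)
        \<le> std_normal_density z * exp (t * z\<^sup>2)"
      by (simp add: sum_distrib_left mult_ac)
  qed (use sum has_integral_std_normal_exp_square [OF t(2)] in \<open>auto simp: has_bochner_integral_iff\<close>)
  also have "\<dots> = 1 / sqrt (1 - 2 * t)"
    using has_integral_std_normal_exp_square [OF t(2)] by (simp add: has_bochner_integral_iff)
  finally show ?thesis unfolding E y_def .
qed

text \<open>
  Averaging over the sign of one more coordinate removes all odd powers of that coordinate, so that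
  both moments satisfy a recursion in the index set. The constant 3 is the fourth moment of a
  standard Gaussian.
\<close>

lemma signs_moments:
  assumes "finite I"
  shows "measure_pmf.expectation (signs_pmf I) (\<lambda>x. (\<Sum>i\<in>I. u i * x i)\<^sup>2) = (\<Sum>i\<in>I. (u i)\<^sup>2)"
    and "measure_pmf.expectation (signs_pmf I) (\<lambda>x. (\<Sum>i\<in>I. u i * x i) ^ 4) \<le> 3 * (\<Sum>i\<in>I. (u i)\<^sup>2)\<^sup>2"
  using assms
proof (induction I)
  case (insert i I)
  let ?E = "measure_pmf.expectation (signs_pmf I)"
  let ?S = "\<lambda>x. \<Sum>i\<in>I. u i * x i"
  define s where "s = (\<Sum>i\<in>I. (u i)\<^sup>2)"
  have int: "integrable (measure_pmf (signs_pmf I)) f" for f :: "_ \<Rightarrow> real"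
    using insert by (intro integrable_measure_pmf_finite) auto
  have S: "(\<Sum>k\<in>insert i I. u k * (x(i := c)) k) = u i * c + ?S x" for x c
  proof -
    have "(\<Sum>k\<in>I. u k * (x(i := c)) k) = ?S x"
      using insert by (intro sum.cong) auto
    then show ?thesis using insert by simp
  qed
  have avg: "(?E f + ?E g) / 2 = ?E (\<lambda>x. (f x + g x) / 2)" for f g :: "_ \<Rightarrow> real"
    using int by simp
  {
    case 1
    have "(?E (\<lambda>x. (u i * 1 + ?S x)\<^sup>2) + ?E (\<lambda>x. (u i * - 1 + ?S x)\<^sup>2)) / 2
        = ?E (\<lambda>x. (u i)\<^sup>2 + (?S x)\<^sup>2)"
      unfolding avg
      by (intro Bochner_Integration.integral_cong refl) (simp add: power2_eq_square field_simps)
    also have "\<dots> = (u i)\<^sup>2 + s"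
      using insert.IH(1) int by (simp add: s_def)
    finally show ?case
      using insert by (simp only: expectation_signs_insert [OF insert.hyps] S) (simp add: s_def)
  next
    case 2
    have "(?E (\<lambda>x. (u i * 1 + ?S x) ^ 4) + ?E (\<lambda>x. (u i * - 1 + ?S x) ^ 4)) / 2
        = ?E (\<lambda>x. (u i) ^ 4 + 6 * (u i)\<^sup>2 * (?S x)\<^sup>2 + (?S x) ^ 4)"
      unfolding avg
      by (intro Bochner_Integration.integral_cong refl)
        (simp add: power2_eq_square power4_eq_xxxx field_simps)
    also have "\<dots> \<le> (u i) ^ 4 + 6 * (u i)\<^sup>2 * s + 3 * s\<^sup>2"
      using insert.IH int by (simp add: s_def)
    also have "\<dots> \<le> 3 * ((u i)\<^sup>2 + s)\<^sup>2"
      using zero_le_power2 [of "(u i)\<^sup>2"] by (simp add: power2_sum power_mult_distrib)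
    finally show ?case
      using insert by (simp only: expectation_signs_insert [OF insert.hyps] S) (simp add: s_def)
  }
qed auto

text \<open>
  The squared norm of the product of the matrix u, with rows indexed by A and columns
  indexed by I, with the vector x.
\<close>

definition rows_energy :: "'a set \<Rightarrow> 'i set \<Rightarrow> ('a \<Rightarrow> 'i \<Rightarrow> real) \<Rightarrow> ('i \<Rightarrow> real) \<Rightarrow> real" where
  "rows_energy A I u x = (\<Sum>a\<in>A. (\<Sum>i\<in>I. u a i * x i)\<^sup>2)"

text \<open>
  The squared norm of \<open>u x\<close> is a convex combination of the squares \<open>(v\<^sub>a \<bullet> x)\<^sup>2\<close>, where \<open>v\<^sub>a\<close> is the
  normalized row a and its weight is the squared norm of that row. Jensen's inequality thus reduces
  matrices to single vectors. Vanishing rows are normalized to 0, which is why the bound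
  is required on the whole unit ball and not only on the sphere.
\<close>

lemma expectation_convex_rows_energy_le:
  fixes f :: "real \<Rightarrow> real"
  assumes fin: "finite A" "finite I" and f: "convex_on UNIV f"
    and u: "(\<Sum>a\<in>A. \<Sum>i\<in>I. (u a i)\<^sup>2) = 1"
    and bound: "\<And>v. (\<Sum>i\<in>I. (v i)\<^sup>2) \<le> 1 \<Longrightarrow>
      measure_pmf.expectation (signs_pmf I) (\<lambda>x. f ((\<Sum>i\<in>I. v i * x i)\<^sup>2)) \<le> c"
  shows "measure_pmf.expectation (signs_pmf I) (\<lambda>x. f (rows_energy A I u x)) \<le> c"
proof -
  let ?E = "measure_pmf.expectation (signs_pmf I)"
  define w where "w a = (\<Sum>i\<in>I. (u a i)\<^sup>2)" for a
  define v where "v a i = u a i / sqrt (w a)" for a i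
  have w0: "w a \<ge> 0" for a by (simp add: w_def sum_nonneg)
  have int: "integrable (measure_pmf (signs_pmf I)) g" for g :: "_ \<Rightarrow> real"
    using fin by (intro integrable_measure_pmf_finite) auto
  have v: "(\<Sum>i\<in>I. (v a i)\<^sup>2) \<le> 1" for a
    using w0 [of a] by (simp add: v_def power_divide sum_divide_distrib [symmetric])
      (simp add: w_def [symmetric])
  have row: "(\<Sum>i\<in>I. u a i * x i)\<^sup>2 = w a * (\<Sum>i\<in>I. v a i * x i)\<^sup>2" for a x
  proof (cases "w a = 0")
    case True
    then have "\<And>i. i \<in> I \<Longrightarrow> u a i = 0"
      using fin by (simp add: w_def sum_nonneg_eq_0_iff)
    then show ?thesis using True by simp
  next
    case False
    have "(\<Sum>i\<in>I. v a i * x i) = (\<Sum>i\<in>I. u a i * x i) / sqrt (w a)"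
      by (simp add: v_def sum_divide_distrib)
    then show ?thesis using w0 [of a] False by (simp add: power_divide)
  qed
  have "A \<noteq> {}" using u by auto
  then have "?E (\<lambda>x. f (rows_energy A I u x)) \<le> ?E (\<lambda>x. \<Sum>a\<in>A. w a * f ((\<Sum>i\<in>I. v a i * x i)\<^sup>2))"
    unfolding rows_energy_def row
    using convex_on_sum [OF fin(1) _ f, of w "\<lambda>a. (\<Sum>i\<in>I. v a i * x i)\<^sup>2" for x] w0 u
    by (intro integral_mono int) (simp add: w_def)
  also have "\<dots> = (\<Sum>a\<in>A. w a * ?E (\<lambda>x. f ((\<Sum>i\<in>I. v a i * x i)\<^sup>2)))"
    using int by simp
  also have "\<dots> \<le> (\<Sum>a\<in>A. w a * c)"
    by (intro sum_mono mult_left_mono bound v w0)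
  also have "\<dots> = c"
    using u by (simp add: w_def sum_distrib_right [symmetric])
  finally show ?thesis .
qed

context
  fixes A :: "'a set" and I :: "'i set" and u :: "'a \<Rightarrow> 'i \<Rightarrow> real"
  assumes fin: "finite A" "finite I" and u: "(\<Sum>a\<in>A. \<Sum>i\<in>I. (u a i)\<^sup>2) = 1"
begin

lemma expectation_exp_rows_energy_le:
  assumes t: "0 \<le> t" "2 * t < 1"
  shows "measure_pmf.expectation (signs_pmf I) (\<lambda>x. exp (t * rows_energy A I u x)) \<le> 1 / sqrt (1 - 2 * t)"
proof (rule expectation_convex_rows_energy_le [OF fin _ u, where f = "\<lambda>z. exp (t * z)"])
  show "convex_on UNIV (\<lambda>z. exp (t * z))"
    by (rule f''_ge0_imp_convex [where f' = "\<lambda>z. t * exp (t * z)" and f'' = "\<lambda>z. t\<^sup>2 * exp (t * z)"])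
      (auto intro!: derivative_eq_intros simp: power2_eq_square)
qed (rule expectation_signs_exp_square_le [OF fin(2) t])

lemma rows_energy_moments:
  shows "measure_pmf.expectation (signs_pmf I) (\<lambda>x. rows_energy A I u x) = 1"
    and "measure_pmf.expectation (signs_pmf I) (\<lambda>x. (rows_energy A I u x)\<^sup>2) \<le> 3"
proof -
  show "measure_pmf.expectation (signs_pmf I) (\<lambda>x. rows_energy A I u x) = 1"
    unfolding rows_energy_def using fin u
    by (simp add: integrable_measure_pmf_finite signs_moments(1))
  show "measure_pmf.expectation (signs_pmf I) (\<lambda>x. (rows_energy A I u x)\<^sup>2) \<le> 3"
  proof (rule expectation_convex_rows_energy_le [OF fin _ u, where f = power2])
    fix v :: "'i \<Rightarrow> real" assume v: "(\<Sum>i\<in>I. (v i)\<^sup>2) \<le> 1"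
    have "measure_pmf.expectation (signs_pmf I) (\<lambda>x. ((\<Sum>i\<in>I. v i * x i)\<^sup>2)\<^sup>2) \<le> 3 * (\<Sum>i\<in>I. (v i)\<^sup>2)\<^sup>2"
      using signs_moments(2) [OF fin(2), of v] by simp
    also have "\<dots> \<le> 3 * 1"
      using v by (intro mult_left_mono power_le_one) (auto simp: sum_nonneg)
    finally show "measure_pmf.expectation (signs_pmf I) (\<lambda>x. ((\<Sum>i\<in>I. v i * x i)\<^sup>2)\<^sup>2) \<le> 3" by simp
  qed (rule convex_power2)
qed

text \<open>
  Nonnegative variables have good lower tails as soon as their second moment is bounded.
\<close>

lemma expectation_exp_minus_rows_energy_le:
  assumes t: "0 \<le> t"
  shows "measure_pmf.expectation (signs_pmf I) (\<lambda>x. exp (- (t * rows_energy A I u x))) \<le> 1 - t + 3 * t\<^sup>2 / 2"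
proof -
  let ?E = "measure_pmf.expectation (signs_pmf I)"
  have int: "integrable (measure_pmf (signs_pmf I)) g" for g :: "_ \<Rightarrow> real"
    using fin by (intro integrable_measure_pmf_finite) auto
  have nonneg: "0 \<le> rows_energy A I u x" for x
    by (simp add: rows_energy_def sum_nonneg)
  have "?E (\<lambda>x. exp (- (t * rows_energy A I u x)))
      \<le> ?E (\<lambda>x. 1 - t * rows_energy A I u x + t\<^sup>2 / 2 * (rows_energy A I u x)\<^sup>2)"
    using exp_minus_le_quadratic [of "t * rows_energy A I u x" for x] nonneg t
    by (intro integral_mono int) (simp add: power_mult_distrib)
  also have "\<dots> = 1 - t + t\<^sup>2 / 2 * ?E (\<lambda>x. (rows_energy A I u x)\<^sup>2)"
    using int rows_energy_moments(1) by simp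
  also have "\<dots> \<le> 1 - t + t\<^sup>2 / 2 * 3"
    using rows_energy_moments(2) by (intro add_left_mono mult_left_mono) auto
  finally show ?thesis by simp
qed

end

lemma expectation_exp_sum_iid:
  fixes Z :: "'b \<Rightarrow> real" and p :: "'b pmf"
  assumes "finite J" "finite (set_pmf p)"
  shows "measure_pmf.expectation (Pi_pmf J d (\<lambda>_. p)) (\<lambda>W. exp (t * (\<Sum>j\<in>J. Z (W j))))
    = (measure_pmf.expectation p (\<lambda>x. exp (t * Z x))) ^ card J"
proof -
  have "measure_pmf.expectation (Pi_pmf J d (\<lambda>_. p)) (\<lambda>W. exp (t * (\<Sum>j\<in>J. Z (W j))))
      = measure_pmf.expectation (Pi_pmf J d (\<lambda>_. p)) (\<lambda>W. \<Prod>j\<in>J. exp (t * Z (W j)))"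
    using assms by (simp add: exp_sum sum_distrib_left)
  also have "\<dots> = (\<Prod>j\<in>J. measure_pmf.expectation p (\<lambda>x. exp (t * Z x)))"
    using assms by (subst expectation_prod_Pi_pmf) (auto intro: integrable_measure_pmf_finite)
  finally show ?thesis by simp
qed

lemma rows_energy_upper_tail:
  assumes fin: "finite A" "finite I" "finite J" and u: "(\<Sum>a\<in>A. \<Sum>i\<in>I. (u a i)\<^sup>2) = 1" and s: "0 \<le> s"
  shows "measure_pmf.prob (Pi_pmf J d (\<lambda>_. signs_pmf I))
      {W. (\<Sum>j\<in>J. rows_energy A I u (W j)) \<ge> real (card J) * (1 + s)}
    \<le> exp (- (real (card J) * (s - ln (1 + s)) / 2))"
proof -
  \<comment> \<open>the minimizer of \<open>exp (- t (1 + s)) / sqrt (1 - 2 t)\<close>\<close>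
  define t where "t = s / (2 * (1 + s))"
  have t: "0 \<le> t" "2 * t < 1" "1 - 2 * t = 1 / (1 + s)" "t * (1 + s) = s / 2"
    using s by (auto simp: t_def field_simps)
  have fs: "finite (set_pmf (Pi_pmf J d (\<lambda>_. signs_pmf I)))"
    using fin by (auto simp: set_Pi_pmf intro!: finite_PiE_dflt)
  let ?S = "\<lambda>W. \<Sum>j\<in>J. rows_energy A I u (W j)"
  have "measure_pmf.prob (Pi_pmf J d (\<lambda>_. signs_pmf I)) {W. ?S W \<ge> real (card J) * (1 + s)}
      \<le> measure_pmf.expectation (Pi_pmf J d (\<lambda>_. signs_pmf I))
          (\<lambda>W. exp (- (t * (real (card J) * (1 + s)))) * exp (t * ?S W))"
    using t(1) by (intro prob_le_expectation fs)
      (auto simp: exp_add [symmetric] right_diff_distrib [symmetric] intro!: mult_left_mono)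
  also have "\<dots> = exp (- (t * (real (card J) * (1 + s))))
      * (measure_pmf.expectation (signs_pmf I) (\<lambda>x. exp (t * rows_energy A I u x))) ^ card J"
    using fin by (simp add: expectation_exp_sum_iid)
  also have "\<dots> \<le> exp (- (t * (real (card J) * (1 + s)))) * sqrt (1 + s) ^ card J"
    using expectation_exp_rows_energy_le [OF fin(1,2) u t(1,2)]
    by (intro mult_left_mono power_mono integral_nonneg_AE) (auto simp: t(3) real_sqrt_divide)
  also have "sqrt (1 + s) = exp (ln (1 + s) / 2)"
    using s by (simp add: ln_sqrt [symmetric])
  also have "exp (- (t * (real (card J) * (1 + s)))) * exp (ln (1 + s) / 2) ^ card J
      = exp (- (real (card J) * (t * (1 + s))) + real (card J) * (ln (1 + s) / 2))"
    by (simp only: exp_of_nat_mult [symmetric] exp_add mult_ac)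
  also have "\<dots> = exp (- (real (card J) * (s - ln (1 + s)) / 2))"
    unfolding t(4) by (simp add: field_simps)
  finally show ?thesis .
qed

lemma rows_energy_lower_tail:
  assumes fin: "finite A" "finite I" "finite J" and u: "(\<Sum>a\<in>A. \<Sum>i\<in>I. (u a i)\<^sup>2) = 1"
    and s: "0 \<le> s" "s \<le> 1"
  shows "measure_pmf.prob (Pi_pmf J d (\<lambda>_. signs_pmf I))
      {W. (\<Sum>j\<in>J. rows_energy A I u (W j)) \<le> real (card J) * (1 - s)}
    \<le> exp (- (real (card J) * (s\<^sup>2 / 6 + (s * (2 - s) / 6)\<^sup>2 / 2)))"
proof -
  \<comment> \<open>the minimizer of \<open>- t s + 3 t\<^sup>2 / 2\<close>, the leading part of the exponent\<close>
  define t where "t = s / 3"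
  define x where "x = s * (2 - s) / 6"
  have t: "0 \<le> t" "1 - t + 3 * t\<^sup>2 / 2 = 1 - x" "t * (1 - s) = x - s\<^sup>2 / 6"
    using s by (auto simp: t_def x_def power2_eq_square field_simps)
  have "s * (2 - s) \<le> 1 * 2"
    using s by (intro mult_mono) auto
  then have x: "0 \<le> x" "x < 1"
    using s by (auto simp: x_def)
  have fs: "finite (set_pmf (Pi_pmf J d (\<lambda>_. signs_pmf I)))"
    using fin by (auto simp: set_Pi_pmf intro!: finite_PiE_dflt)
  let ?S = "\<lambda>W. \<Sum>j\<in>J. rows_energy A I u (W j)"
  have "measure_pmf.prob (Pi_pmf J d (\<lambda>_. signs_pmf I)) {W. ?S W \<le> real (card J) * (1 - s)}
      \<le> measure_pmf.expectation (Pi_pmf J d (\<lambda>_. signs_pmf I))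
          (\<lambda>W. exp (t * (real (card J) * (1 - s))) * exp (- t * ?S W))"
    using t(1) by (intro prob_le_expectation fs)
      (auto simp: exp_add [symmetric] right_diff_distrib [symmetric] intro!: mult_left_mono)
  also have "\<dots> = exp (t * (real (card J) * (1 - s)))
      * (measure_pmf.expectation (signs_pmf I) (\<lambda>x. exp (- t * rows_energy A I u x))) ^ card J"
    using fin by (simp only: integral_mult_right_zero expectation_exp_sum_iid finite_set_signs_pmf)
  also have "\<dots> \<le> exp (t * (real (card J) * (1 - s))) * exp (- x - x\<^sup>2 / 2) ^ card J"
    using expectation_exp_minus_rows_energy_le [OF fin(1,2) u t(1)] one_minus_le_exp_quadratic [OF x]
    by (intro mult_left_mono power_mono integral_nonneg_AE) (auto simp: t(2))
  also have "\<dots> = exp (real (card J) * (t * (1 - s)) + real (card J) * (- x - x\<^sup>2 / 2))"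
    by (simp only: exp_of_nat_mult [symmetric] exp_add mult_ac)
  also have "\<dots> = exp (- (real (card J) * (s\<^sup>2 / 6 + x\<^sup>2 / 2)))"
    unfolding t(3) by (simp add: algebra_simps)
  finally show ?thesis unfolding x_def .
qed

section \<open>Rademacher sketches\<close>

text \<open>
  The columns of a Rademacher matrix are independent: both sides are uniform distributions, on
  matrices of signs and on families of sign vectors, and currying is a bijection between them.
\<close>

lemma signs_pmf_curry:
  "map_pmf (\<lambda>W j i. W (i, j)) (signs_pmf (UNIV :: ('n :: finite \<times> 'k :: finite) set))
    = Pi_pmf UNIV (\<lambda>_. 0) (\<lambda>_. signs_pmf UNIV)"
proof -
  have "bij_betw (\<lambda>W j i. W (i, j)) (PiE_dflt (UNIV :: ('n \<times> 'k) set) 0 (\<lambda>_. {-1, 1 :: real}))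
      (PiE_dflt UNIV (\<lambda>_. 0) (\<lambda>_. PiE_dflt UNIV 0 (\<lambda>_. {-1, 1})))"
    by (rule bij_betwI [where g = "\<lambda>V p. V (snd p) (fst p)"]) (auto simp: PiE_dflt_def)
  then show ?thesis
    unfolding rademacher_pmf_def
    by (simp add: Pi_pmf_of_set finite_PiE_dflt map_pmf_of_set_bij_betw)
qed

lemma norm_matrix_power2: "(norm M)\<^sup>2 = (\<Sum>i\<in>UNIV. \<Sum>j\<in>UNIV. (M $ i $ j)\<^sup>2)" for M :: "real ^ 'm ^ 'n"
  by (simp add: norm_vec_def L2_set_def sum_nonneg)

lemma norm_rademacher_sketch:
  fixes M :: "real ^ 'n ^ 'a" and W :: "'n \<times> 'k :: finite \<Rightarrow> real"
  shows "(norm (M ** (\<chi> i j. W (i, j) / sqrt (real CARD('k)))))\<^sup>2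
    = (\<Sum>j\<in>UNIV. rows_energy UNIV UNIV (\<lambda>a i. M $ a $ i) (\<lambda>i. W (i, j))) / real CARD('k)"
proof -
  have "(norm (M ** (\<chi> i j. W (i, j) / sqrt (real CARD('k)))))\<^sup>2
      = (\<Sum>a\<in>UNIV. \<Sum>j\<in>UNIV. ((\<Sum>i\<in>UNIV. M $ a $ i * W (i, j)) / sqrt (real CARD('k)))\<^sup>2)"
    by (simp add: norm_matrix_power2 matrix_matrix_mult_def sum_divide_distrib)
  also have "\<dots> = (\<Sum>j\<in>UNIV. \<Sum>a\<in>UNIV. (\<Sum>i\<in>UNIV. M $ a $ i * W (i, j))\<^sup>2 / real CARD('k))"
    by (subst sum.swap) (simp add: power_divide)
  finally show ?thesis
    by (simp add: rows_energy_def sum_divide_distrib)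
qed

text \<open>
  The upper threshold \<open>(1 + e / 20) (1 + e)\<close> equals \<open>1 + s\<close>. For \<open>e = 1\<close>, the claim would fail with
  \<open>s = e\<close>, since \<open>1 - ln 2 < 1 / 3\<close>.
\<close>

lemma rademacher_upper_rate:
  fixes e :: real
  assumes "0 \<le> e" "e \<le> 1"
  defines "s \<equiv> e * (21 + e) / 20"
  shows "e\<^sup>2 / 3 \<le> s - ln (1 + s)"
proof -
  define v where "v = (21 + e) / 20"
  have s: "0 \<le> s" and s_v: "s = e * v"
    using assms by (simp_all add: s_def v_def)
  have "1302 * e + 71 * e\<^sup>2 \<le> 1569"
    using assms power_le_one [of e 2] by linarith
  then have "6 + 4 * (e * v) \<le> 9 * v\<^sup>2"
    by (simp add: v_def power2_eq_square field_simps)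
  then have "e\<^sup>2 * (6 + 4 * (e * v)) \<le> e\<^sup>2 * (9 * v\<^sup>2)"
    by (intro mult_left_mono) auto
  then have "e\<^sup>2 * (6 + 4 * s) \<le> 9 * s\<^sup>2"
    unfolding s_v by (simp add: power_mult_distrib mult_ac)
  then have "e\<^sup>2 / 3 \<le> 3 * s\<^sup>2 / (6 + 4 * s)"
    using s by (simp add: field_simps)
  then show ?thesis
    using ln_one_plus_le_pade [OF s] by linarith
qed

text \<open>
  The lower threshold \<open>(1 + e / 20) (1 - e)\<close> equals \<open>1 - s\<close>. As s is smaller than e, the leading
  term \<open>s\<^sup>2 / 6\<close> alone is not enough; the second one compensates for the difference.
\<close>

lemma rademacher_lower_rate:
  fixes e :: real
  assumes e: "0 \<le> e" "e \<le> 1"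
  defines "s \<equiv> e * (19 + e) / 20"
  shows "e\<^sup>2 / 6 \<le> s\<^sup>2 / 6 + (s * (2 - s) / 6)\<^sup>2 / 2"
proof -
  define q where "q = (1 - e) / 20"
  have q: "0 \<le> q" "q \<le> 1 / 20" and e_q: "e = 1 - 20 * q" and s_q: "s = e * (1 - q)"
    using e by (auto simp: q_def s_def field_simps)
  have "s \<le> e" using e q unfolding s_q by (simp add: mult_left_le)
  then have s2: "(1 + 20 * q)\<^sup>2 \<le> (2 - s)\<^sup>2"
    using e q unfolding e_q by (intro power_mono) auto
  have "(1 - q)\<^sup>2 = 1 - 2 * q + q\<^sup>2"
    by (simp add: power2_diff)
  then have q2: "1 - 2 * q \<le> (1 - q)\<^sup>2"
    using zero_le_power2 [of q] by linarith
  have "q ^ 3 \<le> q\<^sup>2 * (1 / 20)"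
    using mult_left_mono [OF q(2), of "q\<^sup>2"] by (simp add: power3_eq_cube power2_eq_square)
  then have "12 \<le> 13 + 14 * q + 320 * q\<^sup>2 - 800 * q ^ 3"
    using q(1) zero_le_power2 [of q] by linarith
  also have "\<dots> = (1 - 2 * q) * (12 + (1 + 20 * q)\<^sup>2)"
    by (simp add: power2_eq_square power3_eq_cube algebra_simps)
  also have "\<dots> \<le> (1 - q)\<^sup>2 * (12 + (2 - s)\<^sup>2)"
    using q s2 q2 by (intro mult_mono add_left_mono) auto
  finally have "e\<^sup>2 * 12 \<le> e\<^sup>2 * ((1 - q)\<^sup>2 * (12 + (2 - s)\<^sup>2))"
    by (intro mult_left_mono) auto
  also have "\<dots> = s\<^sup>2 * (12 + (2 - s)\<^sup>2)"
    unfolding s_q by (simp add: power_mult_distrib)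
  finally have "e\<^sup>2 * 12 \<le> s\<^sup>2 * 12 + s\<^sup>2 * (2 - s)\<^sup>2"
    by (simp only: distrib_left)
  moreover have "(s * (2 - s) / 6)\<^sup>2 = s\<^sup>2 * (2 - s)\<^sup>2 / 36"
    by (simp add: power_mult_distrib power_divide)
  ultimately show ?thesis
    by linarith
qed

text \<open>
  The scale \<open>1 + e / 20\<close> balances the two tails: it has to exceed 1 to make the upper tail small
  enough for e near 1, and the loss in the lower tail stays within the slack of
  \<open>rademacher_lower_rate\<close>.
\<close>

lemma rademacher_failure_prob:
  fixes M :: "real ^ 'n ^ 'a" and e :: real
  assumes M: "norm M = 1" and e: "0 \<le> e" "e \<le> 1"
  shows "measure_pmf.prob (rademacher_matrix_pmf :: (real ^ 'k ^ 'n) pmf)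
      {V. \<bar>(norm (M ** V))\<^sup>2 - (1 + e / 20)\<bar> > (1 + e / 20) * e} \<le> 2 * exp (- (real CARD('k) * e\<^sup>2 / 6))"
proof -
  let ?K = "real CARD('k)"
  let ?P = "Pi_pmf (UNIV :: 'k set) (\<lambda>_. 0) (\<lambda>_. signs_pmf (UNIV :: 'n set))"
  define S where "S W = (\<Sum>j\<in>UNIV. rows_energy UNIV UNIV (\<lambda>a i. M $ a $ i) (W j))"
    for W :: "'k \<Rightarrow> 'n \<Rightarrow> real"
  define s1 s2 where "s1 = e * (21 + e) / 20" and "s2 = e * (19 + e) / 20"
  have s: "0 \<le> s1" "0 \<le> s2" "s2 \<le> 1"
    using e mult_mono [of e 1 "19 + e" 20] by (auto simp: s1_def s2_def)
  have thresholds: "(1 + e / 20) * (1 + e) = 1 + s1" "(1 + e / 20) * (1 - e) = 1 - s2"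
    by (auto simp: s1_def s2_def field_simps)
  have u: "(\<Sum>a\<in>UNIV. \<Sum>i\<in>UNIV. (M $ a $ i)\<^sup>2) = 1"
    using norm_matrix_power2 [of M] M by simp
  let ?to = "\<lambda>W :: 'n \<times> 'k \<Rightarrow> real. (\<chi> i j. W (i, j) / sqrt ?K) :: real ^ 'k ^ 'n"
  let ?Bad = "{V :: real ^ 'k ^ 'n. \<bar>(norm (M ** V))\<^sup>2 - (1 + e / 20)\<bar> > (1 + e / 20) * e}"
  have "?to -` ?Bad \<subseteq> (\<lambda>W j i. W (i, j)) -` ({W. S W \<ge> ?K * (1 + s1)} \<union> {W. S W \<le> ?K * (1 - s2)})"
  proof
    fix W assume "W \<in> ?to -` ?Bad"
    then have "\<bar>S (\<lambda>j i. W (i, j)) / ?K - (1 + e / 20)\<bar> > (1 + e / 20) * e"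
      by (simp add: norm_rademacher_sketch S_def)
    moreover have "\<bar>x - g\<bar> > g * e \<Longrightarrow> x > g * (1 + e) \<or> x < g * (1 - e)" for x g :: real
      by (auto simp: abs_if algebra_simps split: if_splits)
    ultimately have "S (\<lambda>j i. W (i, j)) / ?K > (1 + e / 20) * (1 + e)
        \<or> S (\<lambda>j i. W (i, j)) / ?K < (1 + e / 20) * (1 - e)"
      by blast
    then show "W \<in> (\<lambda>W j i. W (i, j)) -` ({W. S W \<ge> ?K * (1 + s1)} \<union> {W. S W \<le> ?K * (1 - s2)})"
      unfolding thresholds by (auto simp: field_simps)
  qed
  then have "measure_pmf.prob rademacher_matrix_pmf ?Bad
      \<le> measure_pmf.prob (signs_pmf UNIV)
          ((\<lambda>W j i. W (i, j)) -` ({W. S W \<ge> ?K * (1 + s1)} \<union> {W. S W \<le> ?K * (1 - s2)}))"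
    unfolding rademacher_matrix_pmf_def measure_map_pmf
    by (intro measure_pmf.finite_measure_mono) auto
  also have "\<dots> = measure_pmf.prob ?P ({W. S W \<ge> ?K * (1 + s1)} \<union> {W. S W \<le> ?K * (1 - s2)})"
    unfolding measure_map_pmf [symmetric] signs_pmf_curry ..
  also have "\<dots> \<le> measure_pmf.prob ?P {W. S W \<ge> ?K * (1 + s1)} + measure_pmf.prob ?P {W. S W \<le> ?K * (1 - s2)}"
    by (intro measure_subadditive) (auto simp: measure_pmf.emeasure_eq_measure)
  also have "\<dots> \<le> exp (- (?K * (s1 - ln (1 + s1)) / 2)) + exp (- (?K * (s2\<^sup>2 / 6 + (s2 * (2 - s2) / 6)\<^sup>2 / 2)))"
    unfolding S_def
    by (intro add_mono rows_energy_upper_tail rows_energy_lower_tail u s) auto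
  also have "\<dots> \<le> exp (- (?K * (e\<^sup>2 / 6))) + exp (- (?K * (e\<^sup>2 / 6)))"
  proof -
    have "?K * (e\<^sup>2 / 6) \<le> ?K * ((s1 - ln (1 + s1)) / 2)"
      using rademacher_upper_rate [OF e] unfolding s1_def by (intro mult_left_mono) auto
    moreover have "?K * (e\<^sup>2 / 6) \<le> ?K * (s2\<^sup>2 / 6 + (s2 * (2 - s2) / 6)\<^sup>2 / 2)"
      using rademacher_lower_rate [OF e] unfolding s2_def by (intro mult_left_mono) auto
    ultimately show ?thesis by (intro add_mono) auto
  qed
  finally show ?thesis by simp
qed

section \<open>Sampling without replacement\<close>

text \<open>
  Bernoulli's inequality in homogeneous form: the graph of a power lies above its tangent at a.
\<close>

lemma power_tangent_le:
  fixes a d :: real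
  assumes "0 \<le> a" "0 \<le> a + d"
  shows "a ^ Suc k + real (Suc k) * d * a ^ k \<le> (a + d) ^ Suc k"
proof (cases "a = 0")
  case True
  then show ?thesis using assms by (cases k) auto
next
  case False
  have "- 1 \<le> d / a" using assms False by (simp add: field_simps)
  then have "a ^ Suc k * (1 + real (Suc k) * (d / a)) \<le> a ^ Suc k * (1 + d / a) ^ Suc k"
    using assms by (intro mult_left_mono Bernoulli_inequality) auto
  also have "\<dots> = (a * (1 + d / a)) ^ Suc k"
    by (simp only: power_mult_distrib)
  also have "a * (1 + d / a) = a + d"
    using False by (simp add: field_simps)
  finally have "a ^ Suc k * (1 + real (Suc k) * (d / a)) \<le> (a + d) ^ Suc k" .
  moreover have "a ^ Suc k * (real (Suc k) * (d / a)) = real (Suc k) * d * a ^ k"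
    using False by (simp del: of_nat_Suc)
  ultimately show ?thesis
    by (simp only: distrib_left mult_1_right)
qed

text \<open>
  The weak form of Maclaurin's inequality. When a number \<open>x a\<close> is added to a family of s numbers with
  mean \<open>\<mu>\<close>, the mean becomes \<open>\<nu>\<close> with \<open>x a = \<mu> + (s + 1) (\<nu> - \<mu>)\<close>. The induction hypothesis bounds the
  new elementary symmetric polynomial of degree \<open>j + 1\<close> by \<open>Suc s choose Suc j\<close> times
  \<open>\<mu> ^ (j + 1) + (j + 1) (\<nu> - \<mu>) \<mu> ^ j\<close>, the value at \<open>\<nu>\<close> of the tangent of the power at \<open>\<mu>\<close>.
\<close>

lemma elementary_symmetric_le_mean_power:
  fixes x :: "'i \<Rightarrow> real"
  assumes "finite I" and "\<And>i. i \<in> I \<Longrightarrow> 0 \<le> x i"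
  shows "(\<Sum>S\<in>{S. S \<subseteq> I \<and> card S = k}. \<Prod>i\<in>S. x i)
    \<le> real (card I choose k) * ((\<Sum>i\<in>I. x i) / real (card I)) ^ k"
  using assms
proof (induction I arbitrary: k rule: finite_induct)
  case empty
  have "{S :: 'i set. S \<subseteq> {} \<and> card S = k} = (if k = 0 then {{}} else {})"
    by auto
  then show ?case by simp
next
  case (insert a I)
  show ?case
  proof (cases k)
    case 0
    have "{S. S \<subseteq> insert a I \<and> card S = 0} = {{}}"
      using insert.hyps by (auto simp: card_eq_0_iff dest: finite_subset)
    then show ?thesis using 0 by simp
  next
    case (Suc j)
    define e where "e l = (\<Sum>S\<in>{S. S \<subseteq> I \<and> card S = l}. \<Prod>i\<in>S. x i)" for l
    define s where "s = card I"
    define \<mu> where "\<mu> = (\<Sum>i\<in>I. x i) / real s"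
    define \<nu> where "\<nu> = (\<Sum>i\<in>insert a I. x i) / real (Suc s)"
    have \<mu>0: "0 \<le> \<mu>" and \<nu>0: "0 \<le> \<nu>"
      using insert.prems unfolding \<mu>_def \<nu>_def by (auto intro!: divide_nonneg_nonneg sum_nonneg)
    have sum_I: "(\<Sum>i\<in>I. x i) = real s * \<mu>"
      using insert.hyps by (cases "s = 0") (auto simp: \<mu>_def s_def)
    have xa: "x a = \<mu> + real (Suc s) * (\<nu> - \<mu>)"
      using insert.hyps sum_I unfolding \<nu>_def by (simp add: field_simps)
    have fin: "finite {S. S \<subseteq> I \<and> card S = l}" for l
      using insert.hyps by simp
    have IH: "e l \<le> real (s choose l) * \<mu> ^ l" for l
      unfolding e_def \<mu>_def s_def by (rule insert.IH) (use insert.prems in simp)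
    have xa0: "0 \<le> x a"
      using insert.prems by simp
    have split: "{S. S \<subseteq> insert a I \<and> card S = Suc j}
        = {S. S \<subseteq> I \<and> card S = Suc j} \<union> Set.insert a ` {S. S \<subseteq> I \<and> card S = j}"
    proof (intro equalityI subsetI)
      fix S assume S: "S \<in> {S. S \<subseteq> insert a I \<and> card S = Suc j}"
      show "S \<in> {S. S \<subseteq> I \<and> card S = Suc j} \<union> Set.insert a ` {S. S \<subseteq> I \<and> card S = j}"
      proof (cases "a \<in> S")
        case True
        then have "S = Set.insert a (S - {a})" "S - {a} \<subseteq> I" "card (S - {a}) = j"
          using S by auto
        then show ?thesis by blast
      qed (use S in auto)
    next
      fix S assume "S \<in> {S. S \<subseteq> I \<and> card S = Suc j} \<union> Set.insert a ` {S. S \<subseteq> I \<and> card S = j}"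
      then show "S \<in> {S. S \<subseteq> insert a I \<and> card S = Suc j}"
      proof
        assume "S \<in> Set.insert a ` {S. S \<subseteq> I \<and> card S = j}"
        then obtain S' where "S = Set.insert a S'" "S' \<subseteq> I" "card S' = j" by blast
        moreover from this have "finite S'" "a \<notin> S'"
          using insert.hyps finite_subset by auto
        ultimately show ?thesis by auto
      qed auto
    qed
    have inj: "inj_on (Set.insert a) {S. S \<subseteq> I \<and> card S = j}"
    proof (rule inj_onI)
      fix S S' assume "S \<in> {S. S \<subseteq> I \<and> card S = j}" "S' \<in> {S. S \<subseteq> I \<and> card S = j}"
        and "Set.insert a S = Set.insert a S'"
      then show "S = S'" using insert.hyps(2) by (metis (mono_tags, lifting) insert_ident mem_Collect_eq subset_iff)
    qed
    have ins: "(\<Prod>i\<in>Set.insert a S. x i) = x a * (\<Prod>i\<in>S. x i)" if "S \<subseteq> I" for S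
    proof -
      have "finite S" "a \<notin> S" using that insert.hyps finite_subset by auto
      then show ?thesis by simp
    qed
    have "(\<Sum>S\<in>{S. S \<subseteq> insert a I \<and> card S = Suc j}. \<Prod>i\<in>S. x i)
        = e (Suc j) + (\<Sum>S\<in>Set.insert a ` {S. S \<subseteq> I \<and> card S = j}. \<Prod>i\<in>S. x i)"
      unfolding split e_def using fin insert.hyps(2) by (intro sum.union_disjoint) auto
    also have "\<dots> = e (Suc j) + x a * e j"
      unfolding e_def by (subst sum.reindex [OF inj]) (simp add: ins sum_distrib_left)
    also have "\<dots> \<le> real (s choose Suc j) * \<mu> ^ Suc j + x a * (real (s choose j) * \<mu> ^ j)"
      by (intro add_mono mult_left_mono IH xa0)
    also have "\<dots> = real (Suc s choose Suc j) * \<mu> ^ Suc j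
        + (real (Suc s) * real (s choose j)) * ((\<nu> - \<mu>) * \<mu> ^ j)"
      unfolding xa by (simp add: algebra_simps)
    also have "real (Suc s) * real (s choose j) = real (Suc s choose Suc j) * real (Suc j)"
      by (metis Suc_times_binomial_eq of_nat_mult)
    also have "real (Suc s choose Suc j) * \<mu> ^ Suc j
          + real (Suc s choose Suc j) * real (Suc j) * ((\<nu> - \<mu>) * \<mu> ^ j)
        = real (Suc s choose Suc j) * (\<mu> ^ Suc j + real (Suc j) * (\<nu> - \<mu>) * \<mu> ^ j)"
      by (simp only: distrib_left mult.assoc)
    also have "\<dots> \<le> real (Suc s choose Suc j) * \<nu> ^ Suc j"
      using power_tangent_le [OF \<mu>0, of "\<nu> - \<mu>" j] \<nu>0 by (intro mult_left_mono) auto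
    finally show ?thesis
      using insert.hyps unfolding Suc \<nu>_def s_def by simp
  qed
qed

text \<open>
  The ordered samples without replacement from I, indexed by the type of the arguments.
\<close>

definition injections :: "'i set \<Rightarrow> ('k \<Rightarrow> 'i) set" where
  "injections I = {r. inj r \<and> range r \<subseteq> I}"

lemma finite_injections [simp]:
  assumes "finite I" shows "finite (injections I :: ('k :: finite \<Rightarrow> 'i) set)"
  by (rule finite_subset [of _ "PiE UNIV (\<lambda>_. I)"])
    (use assms in \<open>auto simp: injections_def intro: finite_PiE\<close>)

text \<open>
  Products over an ordered sample only depend on its range, and each subset of the right size is
  the range of equally many samples. The common number c does not depend on x, so it
  cancels from expectations and needs no evaluation.
\<close>

lemma sum_injections:
  assumes "finite I"
  shows "\<exists>c. \<forall>x :: 'i \<Rightarrow> real. (\<Sum>r\<in>(injections I :: ('k :: finite \<Rightarrow> 'i) set). \<Prod>j\<in>UNIV. x (r j))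
    = real c * (\<Sum>S\<in>{S. S \<subseteq> I \<and> card S = CARD('k)}. \<Prod>i\<in>S. x i)"
proof -
  define R :: "'i set \<Rightarrow> ('k \<Rightarrow> 'i) set" where "R S = {r \<in> injections I. range r = S}" for S
  let ?T = "{S. S \<subseteq> I \<and> card S = CARD('k)}"
  have le: "card (R S) \<le> card (R S')" if S: "S \<in> ?T" "S' \<in> ?T" for S S'
  proof -
    have "finite S" "finite S'"
      using S assms finite_subset by auto
    then obtain f where f: "bij_betw f S S'"
      using finite_same_card_bij [of S S'] S by auto
    have "(\<lambda>r. f \<circ> r) ` R S \<subseteq> R S'"
    proof
      fix q assume "q \<in> (\<lambda>r. f \<circ> r) ` R S"
      then obtain r where r: "q = f \<circ> r" "inj r" "range r = S"
        by (auto simp: R_def injections_def)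
      have "inj q" unfolding r(1)
        using r f by (intro comp_inj_on) (auto simp: bij_betw_def)
      moreover have "range q = S'"
        using r f by (metis bij_betw_imp_surj_on image_comp)
      ultimately show "q \<in> R S'" using S by (auto simp: R_def injections_def)
    qed
    moreover have "inj_on (\<lambda>r. f \<circ> r) (R S)"
    proof (intro inj_onI ext)
      fix r r' j assume r: "r \<in> R S" "r' \<in> R S" and eq: "f \<circ> r = f \<circ> r'"
      have "f (r j) = f (r' j)" using eq by (metis comp_apply)
      moreover have "r j \<in> S" "r' j \<in> S" using r by (auto simp: R_def)
      ultimately show "r j = r' j"
        using f by (auto simp: bij_betw_def dest: inj_onD)
    qed
    moreover have "finite (R S')" using assms by (simp add: R_def)
    ultimately show ?thesis by (intro card_inj_on_le)
  qed
  define c where "c = card (R (SOME S. S \<in> ?T))"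
  have c: "card (R S) = c" if "S \<in> ?T" for S
    unfolding c_def using le [OF that someI [of "\<lambda>S. S \<in> ?T", OF that]]
      le [OF someI [of "\<lambda>S. S \<in> ?T", OF that] that] by (rule le_antisym)
  have "(\<Sum>r\<in>(injections I :: ('k \<Rightarrow> 'i) set). \<Prod>j\<in>UNIV. x (r j)) = real c * (\<Sum>S\<in>?T. \<Prod>i\<in>S. x i)" for x :: "'i \<Rightarrow> real"
  proof -
    have "(\<Sum>r\<in>(injections I :: ('k \<Rightarrow> 'i) set). \<Prod>j\<in>UNIV. x (r j)) = (\<Sum>S\<in>?T. \<Sum>r\<in>R S. \<Prod>j\<in>UNIV. x (r j))"
      unfolding R_def using assms finite_injections [OF assms, where 'k = 'k]
      by (intro sum.group [symmetric, where g = range]) (auto simp: injections_def card_image)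
    also have "\<dots> = (\<Sum>S\<in>?T. \<Sum>r\<in>R S. \<Prod>i\<in>S. x i)"
    proof (intro sum.cong refl)
      fix S r assume "r \<in> R S"
      then have "inj r" "S = range r" by (auto simp: R_def injections_def)
      then show "(\<Prod>j\<in>UNIV. x (r j)) = (\<Prod>i\<in>S. x i)"
        by (simp add: prod.reindex)
    qed
    also have "\<dots> = (\<Sum>S\<in>?T. real c * (\<Prod>i\<in>S. x i))"
      by (intro sum.cong refl) (simp add: c)
    finally show ?thesis by (simp add: sum_distrib_left)
  qed
  then show ?thesis by blast
qed

lemma injections_nonempty:
  assumes "finite I" "CARD('k :: finite) \<le> card I"
  shows "(injections I :: ('k \<Rightarrow> 'i) set) \<noteq> {}"
proof -
  obtain f :: "'k \<Rightarrow> 'i" where "f ` UNIV \<subseteq> I" "inj_on f UNIV"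
    using card_le_inj [of "UNIV :: 'k set" I] assms by auto
  then show ?thesis by (auto simp: injections_def)
qed

lemma expectation_prod_injections_le:
  fixes x :: "'i \<Rightarrow> real"
  assumes I: "finite I" "CARD('k :: finite) \<le> card I" and x: "\<And>i. i \<in> I \<Longrightarrow> 0 \<le> x i"
  shows "measure_pmf.expectation (pmf_of_set (injections I :: ('k \<Rightarrow> 'i) set)) (\<lambda>r. \<Prod>j\<in>UNIV. x (r j))
    \<le> ((\<Sum>i\<in>I. x i) / real (card I)) ^ CARD('k)"
proof -
  let ?R = "injections I :: ('k \<Rightarrow> 'i) set"
  let ?T = "{S. S \<subseteq> I \<and> card S = CARD('k)}"
  define b where "b = real (card I choose CARD('k))"
  obtain c where c: "\<And>x :: 'i \<Rightarrow> real. (\<Sum>r\<in>?R. \<Prod>j\<in>UNIV. x (r j)) = real c * (\<Sum>S\<in>?T. \<Prod>i\<in>S. x i)"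
    using sum_injections [OF I(1), where 'k = 'k] by blast
  have card_R: "real (card ?R) = real c * b"
    using c [of "\<lambda>_. 1"] n_subsets [OF I(1), of "CARD('k)"] by (simp add: b_def)
  have pos: "0 < real (card ?R)"
    using injections_nonempty [OF I] I(1) by (simp add: card_gt_0_iff)
  have "measure_pmf.expectation (pmf_of_set ?R) (\<lambda>r. \<Prod>j\<in>UNIV. x (r j))
      = real c * (\<Sum>S\<in>?T. \<Prod>i\<in>S. x i) / real (card ?R)"
    using injections_nonempty [OF I] I(1) by (subst integral_pmf_of_set) (auto simp: c)
  also have "\<dots> \<le> real c * (b * ((\<Sum>i\<in>I. x i) / real (card I)) ^ CARD('k)) / real (card ?R)"
    unfolding b_def using I x by (intro divide_right_mono mult_left_mono elementary_symmetric_le_mean_power) auto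
  also have "\<dots> = ((\<Sum>i\<in>I. x i) / real (card I)) ^ CARD('k)"
  proof -
    have "real c \<noteq> 0" "b \<noteq> 0"
      using pos unfolding card_R by (metis less_irrefl mult_zero_left mult_zero_right)+
    then show ?thesis unfolding card_R by simp
  qed
  finally show ?thesis .
qed

context
  fixes I :: "'i set" and y :: "'i \<Rightarrow> real" and B :: real
  assumes I: "finite I" "CARD('k :: finite) \<le> card I"
    and y: "\<And>i. i \<in> I \<Longrightarrow> 0 \<le> y i" "\<And>i. i \<in> I \<Longrightarrow> y i \<le> B"
    and mean: "(\<Sum>i\<in>I. y i) = real (card I)" and B: "0 < B"
begin

text \<open>
  An exponential moment of the sum is the expectation of a product of K sampled numbers
  \<open>exp (t y\<^sub>i)\<close>, hence at most the K-th power of their mean, as if they were drawn with replacement.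
  The chord of the exponential over the interval from 0 to B bounds this mean in terms of that
  of y.
\<close>

lemma expectation_exp_sample_le:
  "measure_pmf.expectation (pmf_of_set (injections I :: ('k \<Rightarrow> 'i) set)) (\<lambda>r. exp (t * (\<Sum>j\<in>UNIV. y (r j))))
    \<le> exp (real CARD('k) * ((exp (t * B) - 1) / B))"
proof -
  have cardI: "0 < real (card I)" using I(2) zero_less_card_finite [where 'a = 'k] by linarith
  have exp_le: "exp (t * y i) \<le> 1 + (exp (t * B) - 1) / B * y i" if "i \<in> I" for i
  proof -
    define c where "c = y i / B"
    have c: "0 \<le> c" "c \<le> 1" "y i = c * B"
      using y [OF that] B by (auto simp: c_def)
    have "exp ((1 - c) *\<^sub>R 0 + c *\<^sub>R (t * B)) \<le> (1 - c) * exp 0 + c * exp (t * B)"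
      using c by (intro convex_onD [OF exp_convex]) auto
    moreover have "(exp (t * B) - 1) / B * y i = (exp (t * B) - 1) * c"
      using B by (simp add: c(3))
    ultimately show ?thesis
      by (simp add: c(3) algebra_simps)
  qed
  have "measure_pmf.expectation (pmf_of_set (injections I :: ('k \<Rightarrow> 'i) set)) (\<lambda>r. exp (t * (\<Sum>j\<in>UNIV. y (r j))))
      = measure_pmf.expectation (pmf_of_set (injections I :: ('k \<Rightarrow> 'i) set)) (\<lambda>r. \<Prod>j\<in>UNIV. exp (t * y (r j)))"
    by (simp add: sum_distrib_left exp_sum)
  also have "\<dots> \<le> ((\<Sum>i\<in>I. exp (t * y i)) / real (card I)) ^ CARD('k)"
    by (rule expectation_prod_injections_le [OF I]) simp
  also have "\<dots> \<le> exp ((exp (t * B) - 1) / B) ^ CARD('k)"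
  proof (intro power_mono)
    have "(\<Sum>i\<in>I. exp (t * y i)) \<le> (\<Sum>i\<in>I. 1 + (exp (t * B) - 1) / B * y i)"
      by (intro sum_mono exp_le)
    also have "\<dots> = real (card I) * (1 + (exp (t * B) - 1) / B)"
      unfolding sum.distrib sum_distrib_left [symmetric] mean by (simp add: distrib_left)
    finally have "(\<Sum>i\<in>I. exp (t * y i)) / real (card I) \<le> 1 + (exp (t * B) - 1) / B"
      using cardI by (simp add: field_simps)
    also have "\<dots> \<le> exp ((exp (t * B) - 1) / B)"
      by (rule exp_ge_add_one_self)
    finally show "(\<Sum>i\<in>I. exp (t * y i)) / real (card I) \<le> exp ((exp (t * B) - 1) / B)" .
  qed (simp add: sum_nonneg)
  finally show ?thesis by (simp only: exp_of_nat_mult)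
qed

lemma sample_chernoff:
  "measure_pmf.prob (pmf_of_set (injections I :: ('k \<Rightarrow> 'i) set))
      {r. t * (\<Sum>j\<in>UNIV. y (r j)) \<ge> t * (real CARD('k) * a)}
    \<le> exp (real CARD('k) / B * (exp (t * B) - 1 - t * B * a))"
proof -
  let ?R = "pmf_of_set (injections I :: ('k \<Rightarrow> 'i) set)"
  let ?S = "\<lambda>r. \<Sum>j\<in>UNIV. y (r j)"
  have "measure_pmf.prob ?R {r. t * ?S r \<ge> t * (real CARD('k) * a)}
      \<le> measure_pmf.expectation ?R (\<lambda>r. exp (- (t * (real CARD('k) * a))) * exp (t * ?S r))"
    using injections_nonempty [OF I] I(1)
    by (intro prob_le_expectation) (auto simp: exp_add [symmetric])
  also have "\<dots> \<le> exp (- (t * (real CARD('k) * a))) * exp (real CARD('k) * ((exp (t * B) - 1) / B))"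
    using expectation_exp_sample_le by (simp add: mult_left_mono)
  also have "\<dots> = exp (real CARD('k) / B * (exp (t * B) - 1 - t * B * a))"
    using B by (simp add: exp_add [symmetric] field_simps)
  finally show ?thesis .
qed

lemma sample_upper_tail:
  assumes e: "0 \<le> e"
  shows "measure_pmf.prob (pmf_of_set (injections I :: ('k \<Rightarrow> 'i) set))
      {r. (\<Sum>j\<in>UNIV. y (r j)) \<ge> real CARD('k) * (1 + e)}
    \<le> exp (- (real CARD('k) / B * (e\<^sup>2 / 2 - e ^ 3 / 6)))"
proof -
  \<comment> \<open>the minimizer of \<open>exp (t B) - 1 - t B (1 + e)\<close>\<close>
  define t where "t = ln (1 + e) / B"
  have t: "0 \<le> t" "t * B = ln (1 + e)" using e B by (auto simp: t_def)
  have "measure_pmf.prob (pmf_of_set (injections I :: ('k \<Rightarrow> 'i) set))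
      {r. (\<Sum>j\<in>UNIV. y (r j)) \<ge> real CARD('k) * (1 + e)}
    \<le> measure_pmf.prob (pmf_of_set (injections I :: ('k \<Rightarrow> 'i) set))
      {r. t * (\<Sum>j\<in>UNIV. y (r j)) \<ge> t * (real CARD('k) * (1 + e))}"
    using t(1) by (intro measure_pmf.finite_measure_mono) (auto intro: mult_left_mono)
  also have "\<dots> \<le> exp (real CARD('k) / B * (exp (t * B) - 1 - t * B * (1 + e)))"
    by (rule sample_chernoff)
  also have "\<dots> \<le> exp (real CARD('k) / B * (- (e\<^sup>2 / 2 - e ^ 3 / 6)))"
  proof -
    have "exp (t * B) - 1 - t * B * (1 + e) \<le> - (e\<^sup>2 / 2 - e ^ 3 / 6)"
      using bennett_function_ge [OF e] e unfolding t(2) by (simp add: algebra_simps)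
    then have "real CARD('k) / B * (exp (t * B) - 1 - t * B * (1 + e))
        \<le> real CARD('k) / B * (- (e\<^sup>2 / 2 - e ^ 3 / 6))"
      using B by (intro mult_left_mono) auto
    then show ?thesis by simp
  qed
  finally show ?thesis by (simp only: mult_minus_right)
qed

lemma sample_lower_tail:
  assumes e: "0 \<le> e"
  shows "measure_pmf.prob (pmf_of_set (injections I :: ('k \<Rightarrow> 'i) set))
      {r. (\<Sum>j\<in>UNIV. y (r j)) \<le> real CARD('k) * (1 - e)}
    \<le> exp (- (real CARD('k) / B * (e\<^sup>2 / 2)))"
proof -
  \<comment> \<open>to first order in e, the minimizer of \<open>exp (t B) - 1 - t B (1 - e)\<close>\<close>
  define t where "t = - (e / B)"
  have t: "t \<le> 0" "t * B = - e" using e B by (auto simp: t_def)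
  have "measure_pmf.prob (pmf_of_set (injections I :: ('k \<Rightarrow> 'i) set))
      {r. (\<Sum>j\<in>UNIV. y (r j)) \<le> real CARD('k) * (1 - e)}
    \<le> measure_pmf.prob (pmf_of_set (injections I :: ('k \<Rightarrow> 'i) set))
      {r. t * (\<Sum>j\<in>UNIV. y (r j)) \<ge> t * (real CARD('k) * (1 - e))}"
    using t(1) by (intro measure_pmf.finite_measure_mono) (auto intro: mult_left_mono_neg)
  also have "\<dots> \<le> exp (real CARD('k) / B * (exp (t * B) - 1 - t * B * (1 - e)))"
    by (rule sample_chernoff)
  also have "\<dots> \<le> exp (real CARD('k) / B * (- (e\<^sup>2 / 2)))"
  proof -
    have "exp (t * B) - 1 - t * B * (1 - e) \<le> - (e\<^sup>2 / 2)"
      using exp_minus_le_quadratic [OF e] unfolding t(2) by (simp add: power2_eq_square algebra_simps)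
    then have "real CARD('k) / B * (exp (t * B) - 1 - t * B * (1 - e))
        \<le> real CARD('k) / B * (- (e\<^sup>2 / 2))"
      using B by (intro mult_left_mono) auto
    then show ?thesis by simp
  qed
  finally show ?thesis by (simp only: mult_minus_right)
qed

end

section \<open>Subsampled Hadamard sketches\<close>

lemma hadamard_square [simp]: "(hadamard k i j)\<^sup>2 = 1"
  by (induction k arbitrary: i j)
    (auto simp: kronecker_def hadamard2_def power_mult_distrib)

text \<open>
  The rows of the doubled matrix come in two halves, and the two halves of a column are
  equal or opposite. The inner product of two columns thus consists of two copies of one for
  the smaller matrix, which cancel if the columns belong to different halves.
\<close>

lemma hadamard_columns_orthogonal:
  assumes "p < 2 ^ k" "q < 2 ^ k"
  shows "(\<Sum>l<2 ^ k. hadamard k l p * hadamard k l q) = (if p = q then 2 ^ k else 0)"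
  using assms
proof (induction k arbitrary: p q)
  case (Suc k)
  define P :: nat where "P = 2 ^ k"
  have P: "0 < P" "p < 2 * P" "q < 2 * P" using Suc.prems by (auto simp: P_def)
  define h where "h a b = hadamard2 a b" for a b
  define S where "S = (\<Sum>l<P. hadamard k l (p mod P) * hadamard k l (q mod P))"
  have S: "S = (if p mod P = q mod P then real P else 0)"
    unfolding S_def P_def using Suc.IH [of "p mod 2 ^ k" "q mod 2 ^ k"] by simp
  have entry: "hadamard (Suc k) l r = h (l div P) (r div P) * hadamard k (l mod P) (r mod P)" for l r
    by (simp add: kronecker_def P_def h_def)
  have "{..<2 ^ Suc k} = {..<P} \<union> (+) P ` {..<P}"
  proof (intro equalityI subsetI)
    fix l assume l: "l \<in> {..<2 ^ Suc k :: nat}"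
    show "l \<in> {..<P} \<union> (+) P ` {..<P}"
    proof (cases "l < P")
      case False
      then have "l = P + (l - P)" "l - P < P" using l by (auto simp: P_def)
      then show ?thesis by blast
    qed simp
  qed (auto simp: P_def)
  then have "(\<Sum>l<2 ^ Suc k. hadamard (Suc k) l p * hadamard (Suc k) l q)
      = (\<Sum>l<P. hadamard (Suc k) l p * hadamard (Suc k) l q)
        + (\<Sum>l<P. hadamard (Suc k) (P + l) p * hadamard (Suc k) (P + l) q)"
    by (simp only:, subst sum.union_disjoint) (auto simp: sum.reindex)
  also have "\<dots> = h 0 (p div P) * h 0 (q div P) * S + h 1 (p div P) * h 1 (q div P) * S"
    unfolding S_def sum_distrib_left using P
    by (intro arg_cong2 [of _ _ _ _ "(+)"] sum.cong)
      (auto simp: entry simp del: hadamard.simps)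
  also have "\<dots> = (if p = q then 2 ^ Suc k else 0)"
  proof -
    have div: "p div P = 0 \<or> p div P = 1" "q div P = 0 \<or> q div P = 1"
      using P div_less_iff_less_mult [of P p 2] div_less_iff_less_mult [of P q 2]
      by (auto simp: less_2_cases_iff)
    show ?thesis
    proof (cases "p div P = q div P")
      case True
      then have "p = q \<longleftrightarrow> p mod P = q mod P" by (metis div_mult_mod_eq)
      then show ?thesis using True div by (auto simp: h_def hadamard2_def S P_def)
    next
      case False
      then have "p \<noteq> q" by auto
      then show ?thesis using False div by (auto simp: h_def hadamard2_def)
    qed
  qed
  finally show ?case .
qed simp

lemma srht_matrix_eq:
  assumes "r j < 2 ^ k" "i < 2 ^ k"
  shows "srht_matrix k r d i (j :: 'k :: finite) = hadamard k (r j) i * d i / sqrt (real CARD('k))"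
proof -
  have "(\<Sum>l<2 ^ k. \<Sum>p<2 ^ k. (if l = r j then 1 else 0) * hadamard k l p * (if p = i then d i else 0))
      = (\<Sum>l<2 ^ k. if l = r j then \<Sum>p<2 ^ k. if p = i then hadamard k l p * d i else 0 else 0)"
    by (intro sum.cong refl) (simp add: if_distrib [of "\<lambda>x. _ * x"] cong: if_cong)
  also have "\<dots> = hadamard k (r j) i * d i"
    using assms by (simp only: sum.delta finite_lessThan lessThan_iff if_True)
  finally show ?thesis by (simp only: srht_matrix_def Let_def)
qed

lemma srht_size_bounds:
  assumes "1 \<le> n"
  shows "n \<le> srht_size n" "srht_size n \<le> 2 * n"
proof -
  have pos: "0 \<le> log 2 (real n)" using assms by simp
  define z where "z = \<lceil>log 2 (real n)\<rceil>"
  have z: "0 \<le> z" using pos by (simp add: z_def)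
  have s: "real (srht_size n) = 2 powr real_of_int z"
    using z by (simp add: srht_size_def srht_exponent_def z_def [symmetric] powr_real_of_int)
  have n: "real n = 2 powr log 2 (real n)" using assms by simp
  have "2 powr log 2 (real n) \<le> 2 powr real_of_int z"
    by (intro powr_mono) (auto simp: z_def)
  then have "real n \<le> real (srht_size n)" using s n by simp
  then show "n \<le> srht_size n" by simp
  have "2 powr real_of_int z \<le> 2 powr (1 + log 2 (real n))"
    unfolding z_def using ceiling_correct [of "log 2 (real n)"] by (intro powr_mono) auto
  then have "real (srht_size n) \<le> 2 * real n" using s n by (simp add: powr_add)
  then show "srht_size n \<le> 2 * n" by linarith
qed

text \<open>
  Conditioning on the first component, where B is an exceptional set that is paid for separately.
\<close>

lemma prob_pair_pmf_le:
  assumes fin: "finite (set_pmf p)" "finite (set_pmf q)" and c: "0 \<le> c"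
    and le: "\<And>x. x \<in> set_pmf p \<Longrightarrow> x \<notin> B \<Longrightarrow> measure_pmf.prob q {y. (x, y) \<in> S} \<le> c"
  shows "measure_pmf.prob (pair_pmf p q) S \<le> measure_pmf.prob p B + c"
proof -
  have "measure_pmf.prob (pair_pmf p q) S = measure_pmf.expectation (p \<bind> (\<lambda>x. map_pmf (Pair x) q)) (indicator S)"
    by (simp add: pair_pmf_def map_pmf_def)
  also have "\<dots> = (\<Sum>x\<in>set_pmf p. pmf p x * measure_pmf.prob q {y. (x, y) \<in> S})"
    using fin by (subst pmf_expectation_bind [of "set_pmf p"]) (auto simp: vimage_def)
  also have "\<dots> \<le> (\<Sum>x\<in>set_pmf p. pmf p x * (indicator B x + c))"
  proof (intro sum_mono mult_left_mono)
    fix x assume "x \<in> set_pmf p"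
    then show "measure_pmf.prob q {y. (x, y) \<in> S} \<le> indicator B x + c"
      using le [of x] c by (cases "x \<in> B") (auto intro: add_increasing2)
  qed simp
  also have "\<dots> = measure_pmf.expectation p (\<lambda>x. indicator B x + c)"
    using fin by (subst integral_measure_pmf_real [of "set_pmf p"]) (auto simp: mult.commute)
  also have "\<dots> = measure_pmf.prob p B + c"
    using fin by (subst Bochner_Integration.integral_add) (auto intro: integrable_measure_pmf_finite)
  finally show ?thesis .
qed

text \<open>
  The squared norm of row l of \<open>H D M\<^sup>T\<close>, where H is the Hadamard matrix, D has diagonal d, and
  column i of M is placed at position \<open>idx i\<close>. The squared norm of a P-SRHT sketch of M is
  the average of these numbers over K sampled rows l.
\<close>

definition mixed_row_energy :: "nat \<Rightarrow> ('n \<Rightarrow> nat) \<Rightarrow> real ^ 'n ^ 'a \<Rightarrow> (nat \<Rightarrow> real) \<Rightarrow> nat \<Rightarrow> real" where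
  "mixed_row_energy k idx M d l = (\<Sum>a\<in>UNIV. (\<Sum>i\<in>UNIV. M $ a $ i * (hadamard k l (idx i) * d (idx i)))\<^sup>2)"

lemma norm_srht_sketch:
  fixes M :: "real ^ 'n ^ 'a" and r :: "'k :: finite \<Rightarrow> nat"
  assumes "\<And>i. idx i < 2 ^ k" "\<And>j. r j < 2 ^ k"
  shows "(norm (M ** (\<chi> i j. srht_matrix k r d (idx i) j)))\<^sup>2
    = (\<Sum>j\<in>UNIV. mixed_row_energy k idx M d (r j)) / real CARD('k)"
proof -
  have "(norm (M ** (\<chi> i j. srht_matrix k r d (idx i) j)))\<^sup>2
      = (\<Sum>a\<in>UNIV. \<Sum>j\<in>UNIV. ((\<Sum>i\<in>UNIV. M $ a $ i * (hadamard k (r j) (idx i) * d (idx i))) / sqrt (real CARD('k)))\<^sup>2)"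
    using assms by (simp add: norm_matrix_power2 matrix_matrix_mult_def srht_matrix_eq sum_divide_distrib)
  also have "\<dots> = (\<Sum>j\<in>UNIV. \<Sum>a\<in>UNIV. (\<Sum>i\<in>UNIV. M $ a $ i * (hadamard k (r j) (idx i) * d (idx i)))\<^sup>2 / real CARD('k))"
    by (subst sum.swap) (simp add: power_divide)
  finally show ?thesis
    by (simp add: mixed_row_energy_def sum_divide_distrib)
qed

text \<open>
  The columns of H are orthogonal with squared norm \<open>2 ^ k\<close> and signs do not change norms, so the
  energy of M is redistributed among the rows without loss: the mean energy is \<open>norm M\<^sup>2\<close>.
\<close>

lemma sum_mixed_row_energy:
  fixes M :: "real ^ 'n ^ 'a"
  assumes idx: "inj idx" "\<And>i. idx i < 2 ^ k" and d: "\<And>i. (d (idx i))\<^sup>2 = 1"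
  shows "(\<Sum>l<2 ^ k. mixed_row_energy k idx M d l) = 2 ^ k * (norm M)\<^sup>2"
proof -
  have row: "(\<Sum>l<2 ^ k. (\<Sum>i\<in>UNIV. v i * (hadamard k l (idx i) * d (idx i)))\<^sup>2) = 2 ^ k * (\<Sum>i\<in>UNIV. (v i)\<^sup>2)"
    for v :: "'n \<Rightarrow> real"
  proof -
    define w where "w i = v i * d (idx i)" for i
    have "(\<Sum>l<2 ^ k. (\<Sum>i\<in>UNIV. v i * (hadamard k l (idx i) * d (idx i)))\<^sup>2)
        = (\<Sum>l<2 ^ k. \<Sum>i\<in>UNIV. \<Sum>i'\<in>UNIV. w i * w i' * (hadamard k l (idx i) * hadamard k l (idx i')))"
      by (simp add: power2_eq_square sum_product w_def mult_ac)
    also have "\<dots> = (\<Sum>i\<in>UNIV. \<Sum>i'\<in>UNIV. w i * w i' * (\<Sum>l<2 ^ k. hadamard k l (idx i) * hadamard k l (idx i')))"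
      unfolding sum_distrib_left by (subst sum.swap, intro sum.cong refl, subst sum.swap) simp
    also have "\<dots> = (\<Sum>i\<in>UNIV. \<Sum>i'\<in>UNIV. if i = i' then w i * w i' * 2 ^ k else 0)"
      using idx by (intro sum.cong refl) (auto simp: hadamard_columns_orthogonal inj_eq)
    also have "\<dots> = (\<Sum>i\<in>UNIV. 2 ^ k * (v i)\<^sup>2)"
    proof (intro sum.cong refl)
      fix i
      have "w i * w i = (v i)\<^sup>2 * (d (idx i))\<^sup>2"
        by (simp add: w_def power2_eq_square)
      then show "(\<Sum>i'\<in>UNIV. if i = i' then w i * w i' * 2 ^ k else 0) = 2 ^ k * (v i)\<^sup>2"
        by (simp add: d)
    qed
    finally show ?thesis by (simp add: sum_distrib_left)
  qed
  have "(\<Sum>l<2 ^ k. mixed_row_energy k idx M d l)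
      = (\<Sum>a\<in>UNIV. \<Sum>l<2 ^ k. (\<Sum>i\<in>UNIV. M $ a $ i * (hadamard k l (idx i) * d (idx i)))\<^sup>2)"
    unfolding mixed_row_energy_def by (rule sum.swap)
  then show ?thesis
    by (simp add: row norm_matrix_power2 sum_distrib_left)
qed

text \<open>
  As the entries of H are signs, row l of H only changes signs in the columns of M, so that for
  fixed l the energy is the squared norm of a matrix of norm 1 times a random sign
  vector. The exponential moment at \<open>1 / 4\<close>, bounded by \<open>sqrt 2\<close>, is enough.
\<close>

lemma mixed_row_energy_tail:
  fixes M :: "real ^ 'n ^ 'a"
  assumes M: "norm M = 1" and idx: "bij_betw idx UNIV {..<n}" "n \<le> s"
  shows "measure_pmf.prob (signs_pmf {..<s}) {d. mixed_row_energy k idx M d l \<ge> b} \<le> 2 * exp (- b / 4)"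
proof -
  define g where "g = inv_into UNIV idx"
  define u where "u a p = (if p < n then M $ a $ g p * hadamard k l p else 0)" for a p
  have g: "g (idx i) = i" for i
    using idx by (simp add: g_def bij_betw_def inv_into_f_f)
  have idx_lt: "idx i < n" for i
    using idx by (auto simp: bij_betw_def)
  have reindex: "(\<Sum>p<s. if p < n then f p else 0) = (\<Sum>i\<in>UNIV. f (idx i))" for f :: "nat \<Rightarrow> real"
  proof -
    have "(\<Sum>p<s. if p < n then f p else 0) = (\<Sum>p<n. f p)"
      using idx(2) by (intro sum.mono_neutral_cong_right) auto
    then show ?thesis
      using sum.reindex_bij_betw [OF idx(1), of f] by simp
  qed
  have "(\<Sum>p<s. u a p * d p) = (\<Sum>i\<in>UNIV. M $ a $ i * (hadamard k l (idx i) * d (idx i)))" for a d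
  proof -
    have "(\<Sum>p<s. u a p * d p) = (\<Sum>p<s. if p < n then M $ a $ g p * (hadamard k l p * d p) else 0)"
      by (intro sum.cong refl) (simp add: u_def)
    then show ?thesis unfolding reindex g .
  qed
  then have energy: "mixed_row_energy k idx M d l = rows_energy UNIV {..<s} u d" for d
    by (simp add: mixed_row_energy_def rows_energy_def)
  have "(\<Sum>p<s. (u a p)\<^sup>2) = (\<Sum>i\<in>UNIV. (M $ a $ i)\<^sup>2)" for a
  proof -
    have "(\<Sum>p<s. (u a p)\<^sup>2) = (\<Sum>p<s. if p < n then (M $ a $ g p)\<^sup>2 else 0)"
      by (intro sum.cong refl) (simp add: u_def power_mult_distrib)
    then show ?thesis unfolding reindex g .
  qed
  then have u1: "(\<Sum>a\<in>UNIV. \<Sum>p<s. (u a p)\<^sup>2) = 1"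
    using M norm_matrix_power2 [of M] by simp
  have "measure_pmf.prob (signs_pmf {..<s}) {d. rows_energy UNIV {..<s} u d \<ge> b}
      \<le> measure_pmf.expectation (signs_pmf {..<s}) (\<lambda>d. exp (- b / 4) * exp (1 / 4 * rows_energy UNIV {..<s} u d))"
    by (intro prob_le_expectation) (auto simp: exp_add [symmetric])
  also have "\<dots> \<le> exp (- b / 4) * (1 / sqrt (1 - 2 * (1 / 4)))"
    unfolding integral_mult_right_zero
    by (intro mult_left_mono expectation_exp_rows_energy_le u1) auto
  also have "\<dots> \<le> exp (- b / 4) * 2"
  proof -
    have "1 / 2 \<le> sqrt (1 - 2 * (1 / 4) :: real)"
      by (intro real_le_rsqrt) (simp add: power2_eq_square)
    then have "1 / sqrt (1 - 2 * (1 / 4) :: real) \<le> 1 / (1 / 2)"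
      by (intro divide_left_mono) auto
    then show ?thesis by (intro mult_left_mono) auto
  qed
  finally show ?thesis unfolding energy by (simp add: mult.commute)
qed

text \<open>
  The parameter b separates two sources of failure. Either the random signs produce a row of energy
  at least b; there are at most \<open>2 n\<close> rows. Or all energies are below b and the sampled average
  deviates from the mean.
\<close>

lemma psrht_failure_prob:
  fixes M :: "real ^ 'n ^ 'a" and e b :: real
  assumes M: "norm M = 1" and idx: "bij_betw idx UNIV {..<CARD('n)}"
    and K: "CARD('k) \<le> srht_size CARD('n)" and e: "0 \<le> e" "e \<le> 1" and b: "0 < b"
  shows "measure_pmf.prob (psrht_matrix_pmf idx :: (real ^ 'k ^ 'n) pmf) {V. \<bar>(norm (M ** V))\<^sup>2 - 1\<bar> > e}
    \<le> 4 * real CARD('n) * exp (- b / 4)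
      + 2 * exp (- (real CARD('k) / b * ((e\<^sup>2 - e ^ 3 / 3) / 2)))"
proof -
  define k where "k = srht_exponent CARD('n)"
  define s where "s = srht_size CARD('n)"
  define D where "D = signs_pmf {..<s}"
  define R where "R = pmf_of_set (injections {..<s} :: ('k \<Rightarrow> nat) set)"
  define c where "c = exp (- (real CARD('k) / b * ((e\<^sup>2 - e ^ 3 / 3) / 2)))"
  let ?y = "mixed_row_energy k idx M"
  have s: "s = 2 ^ k" by (simp add: s_def k_def srht_size_def)
  have s_bounds: "CARD('n) \<le> s" "s \<le> 2 * CARD('n)"
    unfolding s_def using srht_size_bounds [of "CARD('n)"] by (simp_all add: Suc_leI)
  have inj: "inj idx" using idx by (simp add: bij_betw_def)
  have idx_lt: "idx i < s" for i
    using bij_betwE [OF idx] s_bounds(1) by (auto intro: less_le_trans)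
  have K': "CARD('k) \<le> card {..<s}" using K by (simp add: s_def)
  have set_R: "set_pmf R = injections {..<s}"
    unfolding R_def using injections_nonempty [OF _ K'] by (intro set_pmf_of_set) auto
  define Bad where "Bad = {d. \<exists>l<s. ?y d l \<ge> b}"
  let ?S = "(\<lambda>(d, r). (\<chi> i j. srht_matrix k r d (idx i) j) :: real ^ 'k ^ 'n) -` {V. \<bar>(norm (M ** V))\<^sup>2 - 1\<bar> > e}"
  have "measure_pmf.prob D Bad \<le> (\<Sum>l<s. measure_pmf.prob D {d. ?y d l \<ge> b})"
  proof -
    have "Bad = (\<Union>l\<in>{..<s}. {d. ?y d l \<ge> b})" by (auto simp: Bad_def)
    then show ?thesis
      by (simp only:) (intro measure_pmf.finite_measure_subadditive_finite, auto)
  qed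
  also have "\<dots> \<le> (\<Sum>l<s. 2 * exp (- b / 4))"
    unfolding D_def using mixed_row_energy_tail [OF M idx s_bounds(1)] by (intro sum_mono)
  also have "\<dots> \<le> 4 * real CARD('n) * exp (- b / 4)"
    using s_bounds(2) by simp
  finally have bad: "measure_pmf.prob D Bad \<le> 4 * real CARD('n) * exp (- b / 4)" .
  have good: "measure_pmf.prob R {r. (d, r) \<in> ?S} \<le> 2 * c" if d: "d \<in> set_pmf D" "d \<notin> Bad" for d
  proof -
    have d2: "(d (idx i))\<^sup>2 = 1" for i
      using d(1) idx_lt [of i] by (auto simp: D_def set_Pi_pmf PiE_dflt_def)
    have y: "\<And>l. l \<in> {..<s} \<Longrightarrow> 0 \<le> ?y d l" "\<And>l. l \<in> {..<s} \<Longrightarrow> ?y d l \<le> b"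
      using d(2) by (auto simp: Bad_def mixed_row_energy_def sum_nonneg not_le intro: less_imp_le)
    have mean: "(\<Sum>l\<in>{..<s}. ?y d l) = real (card {..<s})"
      using sum_mixed_row_energy [of idx k d M] inj d2 idx_lt M by (simp add: s)
    let ?T = "\<lambda>r :: 'k \<Rightarrow> nat. \<Sum>j\<in>UNIV. ?y d (r j)"
    have "{r. (d, r) \<in> ?S} \<inter> set_pmf R
        \<subseteq> {r. ?T r \<ge> real CARD('k) * (1 + e)} \<union> {r. ?T r \<le> real CARD('k) * (1 - e)}"
    proof
      fix r assume r: "r \<in> {r. (d, r) \<in> ?S} \<inter> set_pmf R"
      then have "\<And>j. r j < 2 ^ k" unfolding set_R injections_def s by auto
      then have "\<bar>?T r / real CARD('k) - 1\<bar> > e"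
        using r idx_lt by (simp add: norm_srht_sketch s)
      then have "?T r / real CARD('k) > 1 + e \<or> ?T r / real CARD('k) < 1 - e"
        by linarith
      then show "r \<in> {r. ?T r \<ge> real CARD('k) * (1 + e)} \<union> {r. ?T r \<le> real CARD('k) * (1 - e)}"
        by (auto simp: field_simps)
    qed
    then have "measure_pmf.prob R {r. (d, r) \<in> ?S}
        \<le> measure_pmf.prob R ({r. ?T r \<ge> real CARD('k) * (1 + e)} \<union> {r. ?T r \<le> real CARD('k) * (1 - e)})"
      by (subst measure_Int_set_pmf [symmetric]) (intro measure_pmf.finite_measure_mono, auto)
    also have "\<dots> \<le> measure_pmf.prob R {r. ?T r \<ge> real CARD('k) * (1 + e)}
        + measure_pmf.prob R {r. ?T r \<le> real CARD('k) * (1 - e)}"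
      by (intro measure_subadditive) (auto simp: measure_pmf.emeasure_eq_measure)
    also have "\<dots> \<le> exp (- (real CARD('k) / b * (e\<^sup>2 / 2 - e ^ 3 / 6))) + exp (- (real CARD('k) / b * (e\<^sup>2 / 2)))"
      unfolding R_def
      by (intro add_mono sample_upper_tail [OF _ K' y mean b e(1)] sample_lower_tail [OF _ K' y mean b e(1)]) auto
    also have "\<dots> \<le> c + c"
    proof (intro add_mono)
      have eq: "e\<^sup>2 / 2 - e ^ 3 / 6 = (e\<^sup>2 - e ^ 3 / 3) / 2" by (simp add: field_simps)
      show "exp (- (real CARD('k) / b * (e\<^sup>2 / 2 - e ^ 3 / 6))) \<le> c"
        unfolding c_def eq by simp
      have "real CARD('k) / b * ((e\<^sup>2 - e ^ 3 / 3) / 2) \<le> real CARD('k) / b * (e\<^sup>2 / 2)"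
        using e b by (intro mult_left_mono) auto
      then show "exp (- (real CARD('k) / b * (e\<^sup>2 / 2))) \<le> c"
        unfolding c_def by simp
    qed
    finally show ?thesis by simp
  qed
  have "measure_pmf.prob (psrht_matrix_pmf idx :: (real ^ 'k ^ 'n) pmf) {V. \<bar>(norm (M ** V))\<^sup>2 - 1\<bar> > e}
      = measure_pmf.prob (pair_pmf D R) ?S"
    unfolding psrht_matrix_pmf_def measure_map_pmf D_def R_def k_def s_def injections_def ..
  also have "\<dots> \<le> measure_pmf.prob D Bad + 2 * c"
  proof (rule prob_pair_pmf_le)
    show "finite (set_pmf D)" by (simp add: D_def)
    show "finite (set_pmf R)" by (simp add: set_R)
    show "0 \<le> 2 * c" by (simp add: c_def)
  qed (rule good)
  finally show ?thesis using bad unfolding c_def by linarith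
qed

section \<open>Quasi-optimality of the sketched minimizer\<close>

lemma rademacher_budget:
  fixes K n N \<delta> \<epsilon> :: real
  assumes "0 < \<epsilon>" "1 \<le> n" "0 < N" "0 < \<delta>"
    and K: "K \<ge> 6 / \<epsilon>\<^sup>2 * ln (2 * n * N / \<delta>)"
  shows "2 * exp (- (K * \<epsilon>\<^sup>2 / 6)) \<le> \<delta> / N"
proof -
  have pos: "0 < 2 * n * N / \<delta>" using assms by auto
  have "ln (2 * n * N / \<delta>) \<le> K * \<epsilon>\<^sup>2 / 6"
    using K assms(1) by (simp add: field_simps)
  then have "exp (- (K * \<epsilon>\<^sup>2 / 6)) \<le> exp (- ln (2 * n * N / \<delta>))"
    by simp
  also have "\<dots> = \<delta> / (2 * n * N)"
    using pos by (simp add: exp_minus)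
  also have "\<dots> \<le> \<delta> / (2 * N)"
    using assms by (intro divide_left_mono) auto
  finally show ?thesis by simp
qed

text \<open>
  Each of the two tails of the sample contributes \<open>\<delta> / (4 N)\<close>. As \<open>b / 4\<close> is at least twice
  the logarithm in the definition of b, the probability of a row with large energy is quadratic
  in \<open>\<delta> / (n N)\<close>, which leaves room for the number of rows.
\<close>

lemma psrht_budget:
  fixes K n N \<delta> \<epsilon> :: real
  assumes \<epsilon>: "0 < \<epsilon>" "\<epsilon> \<le> 1" and n: "1 \<le> n" and N: "1 \<le> N" and \<delta>: "0 < \<delta>" "\<delta> < 1"
  defines "b \<equiv> (1 + sqrt (8 * ln (4 * n * N / \<delta>)))\<^sup>2"
  assumes K: "K \<ge> 2 / (\<epsilon>\<^sup>2 - \<epsilon> ^ 3 / 3) * ln (4 * N / \<delta>) * b"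
  shows "0 < b" and "4 * n * exp (- b / 4) + 2 * exp (- (K / b * ((\<epsilon>\<^sup>2 - \<epsilon> ^ 3 / 3) / 2))) \<le> \<delta> / N"
proof -
  define L where "L = ln (4 * n * N / \<delta>)"
  have nN: "1 \<le> n * N" using mult_mono [OF n N] n by simp
  then have "\<delta> \<le> 4 * n * N" using \<delta> by linarith
  then have L: "0 \<le> L" using \<delta> by (simp add: L_def)
  have "b = 1 + 2 * sqrt (8 * L) + 8 * L"
    using L by (simp add: b_def L_def [symmetric] power2_sum)
  then have b: "1 \<le> b" "8 * L \<le> b" using L real_sqrt_ge_zero [of "8 * L"] by linarith+
  then show "0 < b" by simp
  have pos: "0 < 4 * n * N / \<delta>" "0 < 4 * N / \<delta>" using n N \<delta> by auto
  have "exp (- b / 4) \<le> exp (- L + - L)" using b by simp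
  also have "\<dots> = \<delta> / (4 * n * N) * (\<delta> / (4 * n * N))"
    unfolding exp_add using pos by (simp add: L_def exp_minus)
  finally have "4 * n * exp (- b / 4) \<le> 4 * n * (\<delta> / (4 * n * N) * (\<delta> / (4 * n * N)))"
    using n by (intro mult_left_mono) auto
  also have "\<dots> = \<delta> / N * (\<delta> / (4 * (n * N)))" using n by simp
  also have "\<dots> \<le> \<delta> / N * (1 / 2)"
  proof (intro mult_left_mono)
    have "\<delta> \<le> 2 * (n * N)" using \<delta> nN by linarith
    then have "\<delta> / (4 * (n * N)) \<le> 2 * (n * N) / (4 * (n * N))"
      using nN by (intro divide_right_mono) auto
    also have "\<dots> = 1 / 2"
      using nN by auto
    finally show "\<delta> / (4 * (n * N)) \<le> 1 / 2" .
  qed (use \<delta> N in auto)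
  finally have A: "4 * n * exp (- b / 4) \<le> \<delta> / N / 2" by simp
  have "\<epsilon> ^ 3 \<le> \<epsilon>\<^sup>2" using \<epsilon> by (intro power_decreasing) auto
  then have r: "0 < \<epsilon>\<^sup>2 - \<epsilon> ^ 3 / 3" using \<epsilon> zero_less_power [of \<epsilon> 2] by linarith
  have "ln (4 * N / \<delta>) \<le> K / b * ((\<epsilon>\<^sup>2 - \<epsilon> ^ 3 / 3) / 2)"
  proof -
    define r where "r = \<epsilon>\<^sup>2 - \<epsilon> ^ 3 / 3"
    have "0 < r" "2 / r * ln (4 * N / \<delta>) * b \<le> K" using r K by (simp_all add: r_def)
    then have "ln (4 * N / \<delta>) \<le> K / b * (r / 2)"
      using b(1) by (simp add: field_simps)
    then show ?thesis by (simp add: r_def)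
  qed
  then have "exp (- (K / b * ((\<epsilon>\<^sup>2 - \<epsilon> ^ 3 / 3) / 2))) \<le> exp (- ln (4 * N / \<delta>))"
    by simp
  also have "\<dots> = \<delta> / (4 * N)"
    using pos by (simp add: exp_minus)
  finally show "4 * n * exp (- b / 4) + 2 * exp (- (K / b * ((\<epsilon>\<^sup>2 - \<epsilon> ^ 3 / 3) / 2))) \<le> \<delta> / N"
    using A by simp
qed

theorem proposition2p5:
  fixes \<Xi> :: "'p set"
    and A :: "'p \<Rightarrow> real ^ 'n ^ 'n"
    and pts :: "nat \<Rightarrow> 'p"
    and m :: nat
    and Y :: "(real ^ 'n ^ 'n) set"
    and \<xi> :: 'p
    and \<delta> \<epsilon> \<epsilon>' C :: real
    and idx :: "'n \<Rightarrow> nat"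
    and law :: "(real ^ 'k ^ 'n) pmf"
  assumes "\<And>x. x \<in> \<Xi> \<Longrightarrow> invertible (A x)"
    and "\<And>i. i \<in> {1..m} \<Longrightarrow> pts i \<in> \<Xi>"
    and "Y = span ((\<lambda>i. matrix_inv (A (pts i))) ` {1..m})"
    and "\<xi> \<in> \<Xi>"
    and "\<delta> > 0" and "0 < \<epsilon>" and "\<epsilon> \<le> 1" and "C > 1"
    and "\<epsilon>' = \<epsilon> * (C + 1) / (C - 1)" and "\<epsilon>' < 1"
    and "bij_betw idx UNIV {..<CARD('n)}"
    and "(law = rademacher_matrix_pmf \<and>
            real CARD('k) \<ge> 6 / \<epsilon>\<^sup>2 * ln (2 * real CARD('n) * (9 * C / \<epsilon>) ^ (m + 1) / \<delta>))
       \<or> (law = psrht_matrix_pmf idx \<and>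
            CARD('k) \<le> srht_size CARD('n) \<and>
            real CARD('k) \<ge> 2 / (\<epsilon>\<^sup>2 - \<epsilon> ^ 3 / 3) * ln (4 * (9 * C / \<epsilon>) ^ (m + 1) / \<delta>)
              * (1 + sqrt (8 * ln (4 * real CARD('n) * (9 * C / \<epsilon>) ^ (m + 1) / \<delta>)))\<^sup>2)"
  shows "measure_pmf.prob law
           {V. \<forall>P. sketched_minimizer (A \<xi>) V Y P \<longrightarrow>
                 norm (mat 1 - P ** A \<xi>)
                   \<le> sqrt ((1 + \<epsilon>') / (1 - \<epsilon>')) * (INF Q\<in>Y. norm (mat 1 - Q ** A \<xi>))}
         \<ge> 1 - \<delta>"
proof -
  define N where "N = (9 * C / \<epsilon>) ^ (m + 1)"
  have N: "1 \<le> N"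
    unfolding N_def using assms(6-8) by (intro one_le_power) (simp add: field_simps)
  have n: "1 \<le> real CARD('n)" by (simp add: Suc_leI)
  note reduction = quasi_optimality_from_pointwise_embedding
    [OF _ assms(6,8,9,10), of _ "\<delta> / N" m \<delta> law "A \<xi>" "\<lambda>i. matrix_inv (A (pts i))", folded assms(3)]
  have p: "0 \<le> \<delta> / N" "(9 * C / \<epsilon>) ^ (m + 1) * (\<delta> / N) \<le> \<delta>"
    unfolding N_def [symmetric] using N assms(5) by auto
  consider "1 \<le> \<delta>" | (rademacher) "law = rademacher_matrix_pmf"
      "real CARD('k) \<ge> 6 / \<epsilon>\<^sup>2 * ln (2 * real CARD('n) * N / \<delta>)"
    | (psrht) "\<delta> < 1" "law = psrht_matrix_pmf idx" "CARD('k) \<le> srht_size CARD('n)"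
      "real CARD('k) \<ge> 2 / (\<epsilon>\<^sup>2 - \<epsilon> ^ 3 / 3) * ln (4 * N / \<delta>)
        * (1 + sqrt (8 * ln (4 * real CARD('n) * N / \<delta>)))\<^sup>2"
    using assms(12) unfolding N_def [symmetric] by linarith
  then show ?thesis
  proof cases
    case 1
    then show ?thesis by (meson diff_le_0_iff_le measure_nonneg order_trans)
  next
    case rademacher
    show ?thesis
    proof (rule reduction [of "1 + \<epsilon> / 20"])
      fix M :: "real ^ 'n ^ 'n" assume "norm M = 1"
      then have "measure_pmf.prob law {V. \<bar>(norm (M ** V))\<^sup>2 - (1 + \<epsilon> / 20)\<bar> > (1 + \<epsilon> / 20) * \<epsilon>}
          \<le> 2 * exp (- (real CARD('k) * \<epsilon>\<^sup>2 / 6))"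
        unfolding rademacher(1) using assms(6,7) by (intro rademacher_failure_prob) auto
      also have "\<dots> \<le> \<delta> / N"
        using rademacher_budget [OF assms(6) n _ assms(5) rademacher(2)] N by simp
      finally show "measure_pmf.prob law {V. \<bar>(norm (M ** V))\<^sup>2 - (1 + \<epsilon> / 20)\<bar> > (1 + \<epsilon> / 20) * \<epsilon>} \<le> \<delta> / N" .
    qed (use assms(6) p in auto)
  next
    case psrht
    define b where "b = (1 + sqrt (8 * ln (4 * real CARD('n) * N / \<delta>)))\<^sup>2"
    note budget = psrht_budget [OF assms(6,7) n N assms(5) psrht(1,4), folded b_def]
    show ?thesis
    proof (rule reduction [of 1])
      fix M :: "real ^ 'n ^ 'n" assume "norm M = 1"
      then have "measure_pmf.prob law {V. \<bar>(norm (M ** V))\<^sup>2 - 1\<bar> > \<epsilon>}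
          \<le> 4 * real CARD('n) * exp (- b / 4)
            + 2 * exp (- (real CARD('k) / b * ((\<epsilon>\<^sup>2 - \<epsilon> ^ 3 / 3) / 2)))"
        unfolding psrht(2) using assms(6,7) budget(1)
        by (intro psrht_failure_prob assms(11) psrht(3)) auto
      also have "\<dots> \<le> \<delta> / N" by (rule budget(2))
      finally show "measure_pmf.prob law {V. \<bar>(norm (M ** V))\<^sup>2 - 1\<bar> > 1 * \<epsilon>} \<le> \<delta> / N" by simp
    qed (use p in auto)
  qed
qed

end
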